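(* Consider the online problem and Algorithm VQB with the doubling trick described in the context (the time horizon $T$ is unknown to the algorithm), and assume the standing assumptions there with constants $R,F,G,K$ and $\beta=KG$. Let $t_i=2^i$ be the index of the first round of the $i$-th epoch, let $x_t^*\in\arg\min\{f_t(x):x\in\chi,\ \boldsymbol g_t(x)\le\boldsymbol0\}$, and set $x_0^*:=x_1^*$. (Case 1) If, for $t\in[t_i,t_{i+1}-1]$, $$\alpha_t=\sqrt{\frac{2^i}{R+\sum_{s=t_i}^{t}\|x_s^*-x_{s-1}^*\|}},\qquad \gamma_t^2=\frac1{2\beta^2}\frac1{\sqrt{2R}},$$ then VQB with the doubling trick ensures, for any unknown horizon $T$, $$\mathrm{Regret}\le O\big(\max\{\sqrt{TV_x},V_{\boldsymbol g}\}\big),\qquad \mathrm{Vio}_k\le O\big(\max\{\sqrt T,V_{\boldsymbol g}\}\big)\quad\text{for all }k=1,\dots,K.$$ (Case 2) If, for $t\in[t_i,t_{i+1}-1]$, $$\alpha_t=\sqrt{\frac{2^i}{R+\sum_{s=t_i}^{t}\|x_s^*-x_{s-1}^*\|}},\qquad \gamma_t^2=\frac1{2\beta^2}\frac1{\sqrt{2R}}\frac1{\sqrt{t-t_i+2}},$$ then VQB with the doubling trick ensures, for any unknown horizon $T$, $$\mathrm{Regret}\le O\big(\sqrt{TV_x}\big),\qquad \mathrm{Vio}_k\le O\big(\max\{T^{3/4},V_{\boldsymbol g}\}\big)\quad\text{for all }k=1,\dots,K.$$ Here $O(\cdot)$ is with respect to the time horizon $T$ and hides factors depending only on the constants $R,F,G,K$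 of the standing assumptions.
   Context: Setting. $\|\cdot\|$ is the Euclidean norm; vector inequalities and maxima are componentwise. $\chi\subseteq\mathbb R^n$ is nonempty, closed, convex; for $t=1,\dots,T$, $f_t:\chi\to\mathbb R$ is a loss function and $\boldsymbol g_t=(g_{t,1},\dots,g_{t,K})^T:\chi\to\mathbb R^K$ a vector of constraint functions. For each $t$ the set $\{x\in\chi:\boldsymbol g_t(x)\le\boldsymbol0\}$ is nonempty. Standing assumptions. (i) $\chi$ is compact with $\|x-y\|\le R$ for all $x,y\in\chi$. (ii) All $f_t$ and $g_{t,k}$ are convex, and $\max\{|f_t(x)|,\|\boldsymbol g_t(x)\|\}\le F$ for all $x\in\chi$ and all $t$. (iii) $\max\{\|\nabla f_t(x)\|,\|\nabla g_{t,k}(x)\|\}\le G$ for all $x\in\chi,k,t$; consequently, with $\beta:=KG$, $\|\boldsymbol g_t(x)-\boldsymbol g_t(y)\|\le\beta\|x-y\|$ on $\chi$. VQB with the doubling trick. Rounds $1,2,\dots,T$ are partitioned into epochs $i=0,1,2,\dots$, epoch $i$ consisting of the $2^i$ rounds $t_i=2^i,\dots,t_{i+1}-1$ (the last epoch is truncated at $T$). At the start of each epoch VQB is reset, with parameters chosen for horizon $2^i$: the dual variable and the "previous" constraint function are set to zero and an arbitrary $x_{t_i}\in\chi$ is played. In detail, within epoch $i$, put $\boldsymbol\lambda(t_i-1):=\boldsymbol0$ and replace $\gamma_{t_i-1}\boldsymbol g_{t_i-1}$ by $\boldsymbol0$ in the formulas below; for each $t$ with $t_i\le t<t_{i+1}-1$,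 $$\boldsymbol\lambda(t)=\max\{\boldsymbol\lambda(t-1)+\gamma_{t-1}\boldsymbol g_{t-1}(x_t),\,-\gamma_{t-1}\boldsymbol g_{t-1}(x_t)\},$$ $$x_{t+1}=\arg\min_{x\in\chi}\ \nabla f_t(x_t)^T(x-x_t)+[\boldsymbol\lambda(t)+\gamma_{t-1}\boldsymbol g_{t-1}(x_t)]^T(\gamma_t\boldsymbol g_t(x))+\alpha_t\|x-x_t\|^2 .$$ Performance measures. $\mathrm{Regret}=\sum_{t=1}^Tf_t(x_t)-\sum_{t=1}^Tf_t(x_t^* )$; $\mathrm{Vio}_k=\sum_{t=1}^Tg_{t,k}(x_t)$; $V_x=\sum_{t=2}^T\|x_t^*-x_{t-1}^*\|$; $V_{\boldsymbol g}=\sum_{t=2}^T\sup_{x\in\chi}\|\boldsymbol g_t(x)-\boldsymbol g_{t-1}(x)\|$.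
   Formalization: In both regret bounds V_x is replaced by max{R, V_x}, since the bound as stated fails for V_x = 0: with χ=[0,1], f_t(x)=x, g_t=0, x_1=1 the regret is positive while V_x=V_g=0; R>0 and G>0 are made explicit. *)

theory Defs
  imports
    "HOL-Analysis.Analysis"
    "HOL-Library.Poly_Mapping"
    "HOL-Library.Discrete_Functions"
begin

text \<open>
  The constants hidden in the O-notation must not depend on the dimension \<open>n\<close>, so \<open>n\<close> has to be
  quantified inside the statement and cannot be a type. Finitely supported sequences are therefore
  made a real inner product space, and \<open>euclid n\<close> below is its \<open>n\<close>-dimensional coordinate
  subspace: \<open>\<real>\<^sup>n\<close> with the usual inner product and the Euclidean norm.
\<close>

instantiation poly_mapping :: (type, real_vector) real_vector
begin

lift_definition scaleR_poly_mapping :: "real \<Rightarrow> ('a \<Rightarrow>\<^sub>0 'b) \<Rightarrow> ('a \<Rightarrow>\<^sub>0 'b)"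
  is "\<lambda>r f k. r *\<^sub>R f k"
  by (rule finite_subset) auto

instance
proof
  fix x y :: "'a \<Rightarrow>\<^sub>0 'b" and r s :: real
  show "r *\<^sub>R (x + y) = r *\<^sub>R x + r *\<^sub>R y"
    by (rule poly_mapping_eqI) (simp add: lookup_add scaleR_poly_mapping.rep_eq scaleR_add_right)
  show "(r + s) *\<^sub>R x = r *\<^sub>R x + s *\<^sub>R x"
    by (rule poly_mapping_eqI) (simp add: lookup_add scaleR_poly_mapping.rep_eq scaleR_add_left)
  show "r *\<^sub>R s *\<^sub>R x = (r * s) *\<^sub>R x" "1 *\<^sub>R x = x"
    by (rule poly_mapping_eqI, simp add: scaleR_poly_mapping.rep_eq)+
qed

end

instantiation poly_mapping :: (type, real_inner) real_inner
begin

definition inner_poly_mapping :: "('a \<Rightarrow>\<^sub>0 'b) \<Rightarrow> ('a \<Rightarrow>\<^sub>0 'b) \<Rightarrow> real" where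
  "inner_poly_mapping x y = (\<Sum>k\<in>Poly_Mapping.keys x. Poly_Mapping.lookup x k \<bullet> Poly_Mapping.lookup y k)"

definition norm_poly_mapping :: "('a \<Rightarrow>\<^sub>0 'b) \<Rightarrow> real" where
  "norm_poly_mapping x = sqrt (x \<bullet> x)"

definition dist_poly_mapping :: "('a \<Rightarrow>\<^sub>0 'b) \<Rightarrow> ('a \<Rightarrow>\<^sub>0 'b) \<Rightarrow> real" where
  "dist_poly_mapping x y = norm (x - y)"

definition sgn_poly_mapping :: "('a \<Rightarrow>\<^sub>0 'b) \<Rightarrow> ('a \<Rightarrow>\<^sub>0 'b)" where
  "sgn_poly_mapping x = x /\<^sub>R norm x"

definition uniformity_poly_mapping :: "(('a \<Rightarrow>\<^sub>0 'b) \<times> ('a \<Rightarrow>\<^sub>0 'b)) filter" where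
  "uniformity_poly_mapping = (INF e\<in>{0<..}. principal {(x, y). dist x y < e})"

definition open_poly_mapping :: "('a \<Rightarrow>\<^sub>0 'b) set \<Rightarrow> bool" where
  "open_poly_mapping U \<longleftrightarrow> (\<forall>x\<in>U. eventually (\<lambda>(x', y). x' = x \<longrightarrow> y \<in> U) uniformity)"

lemma inner_poly_mapping_superset:
  fixes x y :: "'a \<Rightarrow>\<^sub>0 'b"
  assumes "finite A" "Poly_Mapping.keys x \<subseteq> A"
  shows "x \<bullet> y = (\<Sum>k\<in>A. Poly_Mapping.lookup x k \<bullet> Poly_Mapping.lookup y k)"
  unfolding inner_poly_mapping_def
  using assms by (intro sum.mono_neutral_left) (auto simp: in_keys_iff)

instance
proof
  fix x y z :: "'a \<Rightarrow>\<^sub>0 'b" and r :: real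
  show "x \<bullet> y = y \<bullet> x"
    by (simp add: inner_poly_mapping_superset[of "Poly_Mapping.keys x \<union> Poly_Mapping.keys y"] inner_commute)
  have "Poly_Mapping.keys (x + y) \<subseteq> Poly_Mapping.keys x \<union> Poly_Mapping.keys y"
    by (rule Poly_Mapping.keys_add)
  then show "(x + y) \<bullet> z = x \<bullet> z + y \<bullet> z"
    by (simp add: inner_poly_mapping_superset[of "Poly_Mapping.keys x \<union> Poly_Mapping.keys y"]
        lookup_add inner_add_left sum.distrib)
  have "Poly_Mapping.keys (r *\<^sub>R x) \<subseteq> Poly_Mapping.keys x"
    by (auto simp: in_keys_iff scaleR_poly_mapping.rep_eq)
  then show "r *\<^sub>R x \<bullet> y = r * (x \<bullet> y)"
    by (simp add: inner_poly_mapping_superset[of "Poly_Mapping.keys x"]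
        scaleR_poly_mapping.rep_eq sum_distrib_left)
  show "0 \<le> x \<bullet> x"
    by (simp add: inner_poly_mapping_def sum_nonneg)
  show "x \<bullet> x = 0 \<longleftrightarrow> x = 0"
  proof
    assume "x \<bullet> x = 0"
    then have "\<forall>k\<in>Poly_Mapping.keys x. Poly_Mapping.lookup x k = 0"
      by (simp add: inner_poly_mapping_def sum_nonneg_eq_0_iff)
    then show "x = 0"
      by (intro poly_mapping_eqI) (metis in_keys_iff lookup_zero)
  qed (simp add: inner_poly_mapping_def)
qed (simp_all add: norm_poly_mapping_def dist_poly_mapping_def sgn_poly_mapping_def
      uniformity_poly_mapping_def open_poly_mapping_def)

end

definition euclid :: "nat \<Rightarrow> (nat \<Rightarrow>\<^sub>0 real) set" where
  "euclid n = {x. Poly_Mapping.keys x \<subseteq> {..<n}}"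

lemma inner_euclid:
  "x \<in> euclid n \<Longrightarrow> x \<bullet> y = (\<Sum>i<n. Poly_Mapping.lookup x i * Poly_Mapping.lookup y i)"
  unfolding euclid_def by (simp add: inner_poly_mapping_superset[of "{..<n}"])

lemma norm_euclid:
  "x \<in> euclid n \<Longrightarrow> norm x = L2_set (Poly_Mapping.lookup x) {..<n}"
  by (simp add: norm_eq_sqrt_inner inner_euclid L2_set_def power2_eq_square)

text \<open>The functions live on \<open>X\<close> only, hence gradients are taken within \<open>X\<close>.\<close>

definition has_gradient_on ::
    "('v::real_inner \<Rightarrow> real) \<Rightarrow> ('v \<Rightarrow> 'v) \<Rightarrow> 'v set \<Rightarrow> bool" where
  "has_gradient_on h dh X \<longleftrightarrow>
     (\<forall>x\<in>X. (h has_derivative (\<lambda>v. dh x \<bullet> v)) (at x within X))"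

definition feasible :: "'v set \<Rightarrow> ('v \<Rightarrow> real ^ 'k) \<Rightarrow> 'v set" where
  "feasible X gt = {x \<in> X. \<forall>k. gt x $ k \<le> 0}"

definition online_problem ::
    "'v::real_inner set \<Rightarrow> (nat \<Rightarrow> 'v \<Rightarrow> real) \<Rightarrow> (nat \<Rightarrow> 'v \<Rightarrow> 'v) \<Rightarrow>
     (nat \<Rightarrow> 'v \<Rightarrow> real ^ 'k) \<Rightarrow> (nat \<Rightarrow> 'k \<Rightarrow> 'v \<Rightarrow> 'v) \<Rightarrow>
     real \<Rightarrow> real \<Rightarrow> real \<Rightarrow> nat \<Rightarrow> bool" where
  "online_problem X f df g dg R F G T \<longleftrightarrow>
     X \<noteq> {} \<and> closed X \<and> convex X \<and> compact X \<and>
     (\<forall>x\<in>X. \<forall>y\<in>X. norm (x - y) \<le> R) \<and>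
     (\<forall>t\<in>{1..T}.
        feasible X (g t) \<noteq> {} \<and>
        convex_on X (f t) \<and> (\<forall>k. convex_on X (\<lambda>x. g t x $ k)) \<and>
        (\<forall>x\<in>X. max \<bar>f t x\<bar> (norm (g t x)) \<le> F) \<and>
        has_gradient_on (f t) (df t) X \<and>
        (\<forall>k. has_gradient_on (\<lambda>x. g t x $ k) (dg t k) X) \<and>
        (\<forall>x\<in>X. \<forall>k. max (norm (df t x)) (norm (dg t k x)) \<le> G))"

definition optimal_sequence ::
    "'v set \<Rightarrow> (nat \<Rightarrow> 'v \<Rightarrow> real) \<Rightarrow> (nat \<Rightarrow> 'v \<Rightarrow> real ^ 'k) \<Rightarrow> nat \<Rightarrow> (nat \<Rightarrow> 'v) \<Rightarrow> bool" where
  "optimal_sequence X f g T xs \<longleftrightarrow>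
     (\<forall>t\<in>{1..T}. is_arg_min (f t) (\<lambda>x. x \<in> feasible X (g t)) (xs t)) \<and> xs 0 = xs 1"

text \<open>
  For a round \<open>t \<ge> 1\<close> in epoch \<open>i\<close>, i.e. \<open>2 ^ i \<le> t < 2 ^ (i + 1)\<close>, the value below is \<open>2 ^ i\<close>,
  which is both the first round of the epoch and the horizon the epoch is tuned for.
\<close>

definition epoch_start :: "nat \<Rightarrow> nat" where
  "epoch_start t = 2 ^ floor_log t"

definition prev_constraint ::
    "(nat \<Rightarrow> 'v \<Rightarrow> real ^ 'k) \<Rightarrow> (nat \<Rightarrow> real) \<Rightarrow> nat \<Rightarrow> 'v \<Rightarrow> real ^ 'k" where
  "prev_constraint g \<gamma> t y = (if t = epoch_start t then 0 else \<gamma> (t - 1) *\<^sub>R g (t - 1) y)"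

text \<open>
  \<open>vqb_run X df g \<alpha> \<gamma> T x \<Lambda>\<close>: the iterates \<open>x 1, \<dots>, x T\<close> and dual variables \<open>\<Lambda> t\<close> are produced by
  VQB with the doubling trick. The last dual variable of an epoch is never produced by the update,
  so the reset \<open>\<Lambda> (t - 1) = 0\<close> at the first round \<open>t\<close> of the next epoch does not clash with it.
\<close>

definition vqb_run ::
    "'v::real_inner set \<Rightarrow> (nat \<Rightarrow> 'v \<Rightarrow> 'v) \<Rightarrow> (nat \<Rightarrow> 'v \<Rightarrow> real ^ 'k) \<Rightarrow>
     (nat \<Rightarrow> real) \<Rightarrow> (nat \<Rightarrow> real) \<Rightarrow> nat \<Rightarrow> (nat \<Rightarrow> 'v) \<Rightarrow> (nat \<Rightarrow> real ^ 'k) \<Rightarrow> bool" where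
  "vqb_run X df g \<alpha> \<gamma> T x \<Lambda> \<longleftrightarrow>
     (\<forall>t\<in>{1..T}. t = epoch_start t \<longrightarrow> x t \<in> X \<and> \<Lambda> (t - 1) = 0) \<and>
     (\<forall>t\<in>{1..<T}. t + 1 < 2 * epoch_start t \<longrightarrow>
        \<Lambda> t = (\<chi> k. max (\<Lambda> (t - 1) $ k + prev_constraint g \<gamma> t (x t) $ k)
                         (- prev_constraint g \<gamma> t (x t) $ k)) \<and>
        is_arg_min
          (\<lambda>y. df t (x t) \<bullet> (y - x t)
               + (\<Lambda> t + prev_constraint g \<gamma> t (x t)) \<bullet> (\<gamma> t *\<^sub>R g t y)
               + \<alpha> t * (norm (y - x t))\<^sup>2)
          (\<lambda>y. y \<in> X) (x (t + 1)))"

definition step_alpha :: "real \<Rightarrow> (nat \<Rightarrow> 'v::real_inner) \<Rightarrow> nat \<Rightarrow> real" where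
  "step_alpha R xs t =
     sqrt (real (epoch_start t) / (R + (\<Sum>s=epoch_start t..t. norm (xs s - xs (s - 1)))))"

definition step_gamma1 :: "real \<Rightarrow> real \<Rightarrow> nat \<Rightarrow> real" where
  "step_gamma1 R \<beta> t = sqrt (1 / (2 * \<beta>\<^sup>2) * (1 / sqrt (2 * R)))"

definition step_gamma2 :: "real \<Rightarrow> real \<Rightarrow> nat \<Rightarrow> real" where
  "step_gamma2 R \<beta> t =
     sqrt (1 / (2 * \<beta>\<^sup>2) * (1 / sqrt (2 * R)) * (1 / sqrt (real (t - epoch_start t + 2))))"

definition regret ::
    "(nat \<Rightarrow> 'v \<Rightarrow> real) \<Rightarrow> (nat \<Rightarrow> 'v) \<Rightarrow> (nat \<Rightarrow> 'v) \<Rightarrow> nat \<Rightarrow> real" where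
  "regret f x xs T = (\<Sum>t=1..T. f t (x t)) - (\<Sum>t=1..T. f t (xs t))"

definition violation ::
    "(nat \<Rightarrow> 'v \<Rightarrow> real ^ 'k) \<Rightarrow> (nat \<Rightarrow> 'v) \<Rightarrow> nat \<Rightarrow> 'k \<Rightarrow> real" where
  "violation g x T k = (\<Sum>t=1..T. g t (x t) $ k)"

text \<open>
  A regret bound \<open>C * sqrt (T * path_variation xs T)\<close> with uniform \<open>C\<close> presupposes a path variation
  bounded away from zero: it fails for (nearly) constant optima, because already the first decision
  of each epoch is arbitrary and may cost a fixed positive amount. The regret bounds therefore use
  \<open>max R (path_variation xs T)\<close>, which is the path variation itself as soon as that reaches \<open>R\<close>.
\<close>

definition path_variation :: "(nat \<Rightarrow> 'v::real_inner) \<Rightarrow> nat \<Rightarrow> real" where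
  "path_variation xs T = (\<Sum>t=2..T. norm (xs t - xs (t - 1)))"

definition constraint_variation ::
    "'v set \<Rightarrow> (nat \<Rightarrow> 'v \<Rightarrow> real ^ 'k) \<Rightarrow> nat \<Rightarrow> real" where
  "constraint_variation X g T = (\<Sum>t=2..T. SUP x\<in>X. norm (g t x - g (t - 1) x))"

end

(*
  Within one epoch, comparing x (t + 1) with the optimum xs t in the strongly convex update, adding the
  drift of the squared dual variable and writing the product of two consecutive constraint values
  as squares minus the square of their difference makes everything telescope. What remains is
  sqrt (s * (R + path)) plus the sum of the squared differences of consecutive weighted constraint
  values. With constant gamma the latter is of the order of the constraint variation, with
  decreasing gamma it is of order sqrt s. The same inequality bounds the final dual variable of the
  epoch by a multiple of sqrt s, and the constraint violation of the epoch is at most that divided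
  by gamma, up to a constant and the constraint variation of the epoch. Epoch bounds of the form s powr p with p >= 1/2 sum up geometrically.
*)

theory Submission
  imports Defs
begin

section \<open>Convexity and elementary sums\<close>

text \<open>The obstacle is the quadratic cost of the dual update: its drift costs the squared norm
  of a weighted constraint value in every round, which for constant \<open>\<gamma>\<close> would
  add up linearly in the horizon. The extra weight on the previous constraint value in the primal
  step cancels this: the product it contributes turns that square into a telescoping part plus half
  a squared difference. The difference mixes a change of point with a change of function. Half of
  the quadratic term of the primal step pays for the change of point, which is where the constant in
  \<open>\<gamma>\<close> comes from; the other half pays for linearising the loss, and the change
  of function is the error that stays. Since the comparator moves, distances to consecutive optima
  must be exchanged inside the telescoping sum. As \<open>\<alpha>\<close> is nonincreasing within
  an epoch and divides by the root of the path accumulated so far, all these exchanges together cost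
  only the root of the whole path.\<close>

lemma convex_on_above_gradient:
  assumes "convex_on X h" "has_gradient_on h dh X" "x \<in> X" "y \<in> X"
  shows "h x + dh x \<bullet> (y - x) \<le> h y"
proof -
  define p where "p = (\<lambda>u::real. x + u *\<^sub>R (y - x))"
  have p: "p u = (1 - u) *\<^sub>R x + u *\<^sub>R y" for u
    by (simp add: p_def algebra_simps)
  have pX: "p ` {0..1} \<subseteq> X"
    using convexD_alt[OF convex_on_imp_convex[OF assms(1)] assms(3,4)] by (auto simp: p)
  \<comment> \<open>\<open>x\<close> may lie on the boundary of \<open>X\<close>, so everything is
    restricted to the segment and the derivative at parameter 0 is one-sided.\<close>
  have "(h has_derivative (\<lambda>v. dh x \<bullet> v)) (at (p 0) within p ` {0..1})"
    using assms(2,3) pX by (auto simp: has_gradient_on_def p_def intro: has_derivative_subset)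
  moreover have "(p has_derivative (\<lambda>u. u *\<^sub>R (y - x))) (at 0 within {0..1})"
    unfolding p_def by (auto intro!: derivative_eq_intros)
  ultimately have "((\<lambda>u. h (p u)) has_derivative (\<lambda>u. dh x \<bullet> (u *\<^sub>R (y - x)))) (at 0 within {0..1})"
    by (rule has_derivative_in_compose[rotated])
  then have "((\<lambda>u. h (p u)) has_real_derivative dh x \<bullet> (y - x)) (at 0 within {0..1})"
    by (simp add: has_field_derivative_def mult_commute_abs)
  then have "((\<lambda>u. (h (p u) - h x) / u) \<longlongrightarrow> dh x \<bullet> (y - x)) (at 0 within {0..1})"
    by (simp add: has_field_derivative_iff p_def)
  moreover have "\<forall>\<^sub>F u in at 0 within {0..1}. (h (p u) - h x) / u \<le> h y - h x"
  proof -
    have "(h (p u) - h x) / u \<le> h y - h x" if "0 < u" "u \<le> 1" for u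
    proof -
      have "h (p u) \<le> (1 - u) * h x + u * h y"
        unfolding p using convex_onD[OF assms(1) _ _ assms(3,4)] that by simp
      then show ?thesis
        using that by (simp add: field_simps)
    qed
    then show ?thesis
      by (auto simp: eventually_at intro!: exI[of _ 1])
  qed
  moreover have "at (0::real) within {0..1} \<noteq> bot"
    by (simp add: trivial_limit_within islimpt_Icc)
  ultimately show ?thesis
    using tendsto_upperbound by fastforce
qed

text \<open>Compare \<open>z\<close> with the point at parameter \<open>u\<close> on the segment to
  \<open>y\<close>. The squared distance to \<open>a\<close> obeys an exact identity there, with
  defect \<open>u * (1 - u) * (norm (y - z))\<^sup>2\<close>; dividing by \<open>u\<close> and
  letting \<open>u\<close> tend to 0 leaves the full defect. No optimality condition for
  \<open>\<phi>\<close> is involved.\<close>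

lemma arg_min_proximal_step:
  fixes z a y :: "'v::real_inner"
  assumes conv: "convex_on X \<phi>"
    and min: "is_arg_min (\<lambda>y. \<phi> y + \<alpha> * (norm (y - a))\<^sup>2) (\<lambda>y. y \<in> X) z"
    and y: "y \<in> X"
  shows "\<phi> z + \<alpha> * (norm (z - a))\<^sup>2
           \<le> \<phi> y + \<alpha> * (norm (y - a))\<^sup>2 - \<alpha> * (norm (y - z))\<^sup>2"
proof -
  have z: "z \<in> X" and min': "\<And>w. w \<in> X \<Longrightarrow> \<phi> z + \<alpha> * (norm (z - a))\<^sup>2 \<le> \<phi> w + \<alpha> * (norm (w - a))\<^sup>2"
    using min by (auto simp: is_arg_min_linorder)
  have le: "\<phi> z + \<alpha> * (norm (z - a))\<^sup>2
      \<le> \<phi> y + \<alpha> * (norm (y - a))\<^sup>2 - \<alpha> * (1 - u) * (norm (y - z))\<^sup>2"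
    if u: "0 < u" "u \<le> 1" for u
  proof -
    define w where "w = (1 - u) *\<^sub>R z + u *\<^sub>R y"
    have "w \<in> X"
      unfolding w_def using convexD_alt[OF convex_on_imp_convex[OF conv] z y] u by simp
    then have "\<phi> z + \<alpha> * (norm (z - a))\<^sup>2 \<le> \<phi> w + \<alpha> * (norm (w - a))\<^sup>2"
      by (rule min')
    moreover have "\<phi> w \<le> (1 - u) * \<phi> z + u * \<phi> y"
      unfolding w_def using convex_onD[OF conv _ _ z y] u by simp
    moreover have "(norm (w - a))\<^sup>2
        = (1 - u) * (norm (z - a))\<^sup>2 + u * (norm (y - a))\<^sup>2 - u * (1 - u) * (norm (y - z))\<^sup>2"
    proof -
      have "w - a = (1 - u) *\<^sub>R (z - a) + u *\<^sub>R (y - a)" "y - z = (y - a) - (z - a)"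
        by (simp_all add: w_def algebra_simps)
      then show ?thesis
        by (simp only: power2_norm_eq_inner inner_simps)
          (simp add: inner_commute algebra_simps power2_eq_square)
    qed
    ultimately have "\<phi> z + \<alpha> * (norm (z - a))\<^sup>2 \<le> (1 - u) * \<phi> z + u * \<phi> y
        + \<alpha> * ((1 - u) * (norm (z - a))\<^sup>2 + u * (norm (y - a))\<^sup>2 - u * (1 - u) * (norm (y - z))\<^sup>2)"
      by simp
    then have "u * (\<phi> z + \<alpha> * (norm (z - a))\<^sup>2)
        \<le> u * (\<phi> y + \<alpha> * (norm (y - a))\<^sup>2 - \<alpha> * (1 - u) * (norm (y - z))\<^sup>2)"
      by (simp add: algebra_simps)
    then show ?thesis
      using u by simp
  qed
  have "((\<lambda>u. \<phi> y + \<alpha> * (norm (y - a))\<^sup>2 - \<alpha> * (1 - u) * (norm (y - z))\<^sup>2) \<longlongrightarrow>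
      \<phi> y + \<alpha> * (norm (y - a))\<^sup>2 - \<alpha> * (1 - 0) * (norm (y - z))\<^sup>2) (at_right (0::real))"
    by (intro tendsto_intros)
  moreover have "\<forall>\<^sub>F u in at_right 0. \<phi> z + \<alpha> * (norm (z - a))\<^sup>2
      \<le> \<phi> y + \<alpha> * (norm (y - a))\<^sup>2 - \<alpha> * (1 - u) * (norm (y - z))\<^sup>2"
    using le eventually_at_right_less[of "0::real"]
    by (auto simp: eventually_at_right[OF zero_less_one] intro!: exI[of _ 1])
  ultimately have "\<phi> z + \<alpha> * (norm (z - a))\<^sup>2
      \<le> \<phi> y + \<alpha> * (norm (y - a))\<^sup>2 - \<alpha> * (1 - 0) * (norm (y - z))\<^sup>2"
    by (intro tendsto_lowerbound) auto
  then show ?thesis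
    by simp
qed

text \<open>\<open>M\<close> is the dual update with \<open>p\<close> the weighted previous
  constraint value. The drift bound holds because each component of \<open>M\<close> squares to
  \<open>(L $ k + p $ k)\<^sup>2\<close> or \<open>(p $ k)\<^sup>2\<close>, hence to at most their
  sum.\<close>

lemma dual_update:
  fixes L p :: "real ^ 'k"
  defines "M \<equiv> \<chi> k. max (L $ k + p $ k) (- p $ k)"
  shows dual_update_ge: "L $ k + p $ k \<le> M $ k" "- p $ k \<le> M $ k"
    and dual_update_nonneg: "0 \<le> L $ k \<Longrightarrow> 0 \<le> M $ k"
    and dual_update_norm: "(\<And>k. 0 \<le> L $ k) \<Longrightarrow> norm p \<le> norm M"
    and dual_update_drift: "(norm M)\<^sup>2 \<le> (norm L)\<^sup>2 + 2 * (L \<bullet> p) + 2 * (norm p)\<^sup>2"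
proof -
  show "L $ k + p $ k \<le> M $ k" "- p $ k \<le> M $ k"
    by (simp_all add: M_def)
  show "0 \<le> L $ k \<Longrightarrow> 0 \<le> M $ k"
    by (auto simp: M_def max_def)
  show "norm p \<le> norm M" if "\<And>k. 0 \<le> L $ k"
  proof (rule norm_le_componentwise_cart)
    show "norm (p $ k) \<le> norm (M $ k)" for k
      using that[of k] by (auto simp: M_def)
  qed
  have "(M $ k)\<^sup>2 \<le> (L $ k)\<^sup>2 + 2 * (L $ k * p $ k) + 2 * (p $ k)\<^sup>2" for k
  proof -
    have "(L $ k)\<^sup>2 + 2 * (L $ k * p $ k) + 2 * (p $ k)\<^sup>2 = (L $ k + p $ k)\<^sup>2 + (p $ k)\<^sup>2"
      by (simp add: power2_eq_square algebra_simps)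
    moreover have "(M $ k)\<^sup>2 = (L $ k + p $ k)\<^sup>2 \<or> (M $ k)\<^sup>2 = (p $ k)\<^sup>2"
      by (simp add: M_def max_def)
    ultimately show ?thesis
      by (smt (verit) zero_le_power2)
  qed
  then have "(\<Sum>k\<in>UNIV. (M $ k)\<^sup>2) \<le> (\<Sum>k\<in>UNIV. (L $ k)\<^sup>2 + 2 * (L $ k * p $ k) + 2 * (p $ k)\<^sup>2)"
    by (rule sum_mono)
  then show "(norm M)\<^sup>2 \<le> (norm L)\<^sup>2 + 2 * (L \<bullet> p) + 2 * (norm p)\<^sup>2"
    unfolding power2_norm_eq_inner
    by (simp add: inner_vec_def sum.distrib sum_distrib_left power2_eq_square)
qed

text \<open>Summation by parts: nonincreasing weights only ever shrink the terms carried over. The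
  induction keeps the boundary term \<open>a m * b m\<close>, which is dropped at the end.\<close>

lemma sum_weighted_telescope_le:
  fixes a b :: "nat \<Rightarrow> real"
  assumes "s \<le> m" and nonneg: "\<And>t. t \<in> {s..m} \<Longrightarrow> 0 \<le> a t \<and> 0 \<le> b t \<and> b t \<le> B"
    and anti: "\<And>t. t \<in> {s..<m} \<Longrightarrow> a (t + 1) \<le> a t"
  shows "(\<Sum>t=s..<m. a t * (b t - b (t + 1))) \<le> a s * B"
proof -
  have "(\<Sum>t=s..<m. a t * (b t - b (t + 1))) + a m * b m \<le> a s * B"
    using assms
  proof (induction m rule: dec_induct)
    case base
    then show ?case
      by (auto intro: mult_left_mono)
  next
    case (step m)
    have "a (m + 1) * b (m + 1) \<le> a m * b (m + 1)"
      using step.prems step.hyps by (intro mult_right_mono) auto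
    moreover have "(\<Sum>t=s..<m. a t * (b t - b (t + 1))) + a m * b m \<le> a s * B"
      using step.prems by (intro step.IH) auto
    ultimately show ?case
      using step.hyps by (simp add: algebra_simps)
  qed
  moreover have "0 \<le> a m * b m"
    using nonneg[of m] assms(1) by simp
  ultimately show ?thesis
    by simp
qed

text \<open>The denominator is the total before the increment, so \<open>d \<le> u\<close> is what
  keeps \<open>sqrt (u + d)\<close> below \<open>2 * sqrt u\<close>; hence 3 = 2 + 1. It is applied
  with \<open>u = R + path t\<close>, where the summand \<open>R\<close> dominates every single
  increment.\<close>

lemma increment_div_sqrt_le:
  assumes "0 \<le> d" "d \<le> u" "0 < (u::real)"
  shows "d / sqrt u \<le> 3 * (sqrt (u + d) - sqrt u)"
proof -
  define a b where "a = sqrt u" and "b = sqrt (u + d)"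
  have ab: "a > 0" "a \<le> b" "a\<^sup>2 = u" "b\<^sup>2 = u + d"
    using assms by (auto simp: a_def b_def)
  have "b\<^sup>2 \<le> (2 * a)\<^sup>2"
    unfolding power_mult_distrib ab using assms by simp
  then have "b \<le> 2 * a"
    using ab by (auto intro: power2_le_imp_le)
  have "d = (b - a) * (b + a)"
    using ab by (simp add: power2_eq_square algebra_simps)
  also have "\<dots> \<le> (b - a) * (3 * a)"
    using ab \<open>b \<le> 2 * a\<close> by (intro mult_left_mono) auto
  finally show ?thesis
    using ab unfolding a_def[symmetric] b_def[symmetric] by (simp add: field_simps)
qed

lemma sum_inverse_sqrt_le: "(\<Sum>j<m. 1 / sqrt (real j + 1)) \<le> 2 * sqrt (real m)"
proof (induction m)
  case (Suc m)
  define a b where "a = sqrt (real m)" and "b = sqrt (real m + 1)"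
  have ab: "0 \<le> a" "a \<le> b" "0 < b" "a\<^sup>2 = real m" "b\<^sup>2 = real m + 1"
    by (auto simp: a_def b_def)
  have "1 = (b - a) * (b + a)"
    using ab by (simp add: power2_eq_square algebra_simps)
  also have "\<dots> \<le> (b - a) * (2 * b)"
    using ab by (intro mult_left_mono) auto
  finally have "1 / b \<le> 2 * (b - a)"
    using ab by (simp add: field_simps)
  then show ?case
    using Suc by (simp add: a_def b_def add.commute)
qed simp

lemma abs_diff_le_of_gradient_bound:
  fixes x y :: "'v::real_inner"
  assumes "convex_on X h" "has_gradient_on h dh X" "\<And>z. z \<in> X \<Longrightarrow> norm (dh z) \<le> G"
    and "x \<in> X" "y \<in> X"
  shows "\<bar>h x - h y\<bar> \<le> G * norm (x - y)"
proof -
  have "h u - h v \<le> G * norm (u - v)" if "u \<in> X" "v \<in> X" for u v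
  proof -
    have "h u - h v \<le> dh u \<bullet> (u - v)"
      using convex_on_above_gradient[OF assms(1,2) that] by (simp add: inner_diff_right)
    also have "\<dots> \<le> norm (dh u) * norm (u - v)"
      by (rule norm_cauchy_schwarz)
    also have "\<dots> \<le> G * norm (u - v)"
      using assms(3)[OF that(1)] by (intro mult_right_mono) auto
    finally show ?thesis .
  qed
  from this[of x y] this[of y x] show ?thesis
    using assms(4,5) by (simp add: norm_minus_commute abs_le_iff)
qed

section \<open>One epoch\<close>

lemma online_problemD:
  fixes g :: "nat \<Rightarrow> 'v::real_inner \<Rightarrow> real ^ 'k"
  assumes "online_problem X f df g dg R F G T"
  shows "convex X"
    and "\<And>y z. y \<in> X \<Longrightarrow> z \<in> X \<Longrightarrow> norm (y - z) \<le> R"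
    and "\<And>t y. t \<in> {1..T} \<Longrightarrow> y \<in> X \<Longrightarrow> \<bar>f t y\<bar> \<le> F"
    and "\<And>t y. t \<in> {1..T} \<Longrightarrow> y \<in> X \<Longrightarrow> norm (g t y) \<le> F"
    and "\<And>t y. t \<in> {1..T} \<Longrightarrow> y \<in> X \<Longrightarrow> norm (df t y) \<le> G"
    and "\<And>t k. t \<in> {1..T} \<Longrightarrow> convex_on X (\<lambda>y. g t y $ k)"
    and "\<And>t y z. t \<in> {1..T} \<Longrightarrow> y \<in> X \<Longrightarrow> z \<in> X \<Longrightarrow> f t y + df t y \<bullet> (z - y) \<le> f t z"
    and "\<And>t y z. t \<in> {1..T} \<Longrightarrow> y \<in> X \<Longrightarrow> z \<in> X \<Longrightarrow>
           norm (g t y - g t z) \<le> real CARD('k) * G * norm (y - z)"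
proof -
  note * = assms[unfolded online_problem_def]
  show "convex X" "\<And>y z. y \<in> X \<Longrightarrow> z \<in> X \<Longrightarrow> norm (y - z) \<le> R"
    using * by blast+
  show "\<bar>f t y\<bar> \<le> F" "norm (g t y) \<le> F" "norm (df t y) \<le> G"
    if "t \<in> {1..T}" "y \<in> X" for t y
    using * that by force+
  show "convex_on X (\<lambda>y. g t y $ k)" if "t \<in> {1..T}" for t k
    using * that by blast
  show "f t y + df t y \<bullet> (z - y) \<le> f t z" if "t \<in> {1..T}" "y \<in> X" "z \<in> X" for t y z
    using * that by (intro convex_on_above_gradient[of X]) blast+
  show "norm (g t y - g t z) \<le> real CARD('k) * G * norm (y - z)"
    if t: "t \<in> {1..T}" and yz: "y \<in> X" "z \<in> X" for t y z
  proof -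
    have comp: "\<bar>g t y $ k - g t z $ k\<bar> \<le> G * norm (y - z)" for k
    proof (rule abs_diff_le_of_gradient_bound[of X _ "dg t k"])
      show "norm (dg t k w) \<le> G" if "w \<in> X" for w
        using * t that by force
    qed (use * t yz in blast)+
    \<comment> \<open>Passing to the sum of the components is what produces the number of
      constraints as a factor of the Lipschitz constant.\<close>
    have "norm (g t y - g t z) \<le> (\<Sum>k\<in>UNIV. \<bar>(g t y - g t z) $ k\<bar>)"
      by (rule norm_le_l1_cart)
    also have "\<dots> \<le> (\<Sum>k\<in>(UNIV :: 'k set). G * norm (y - z))"
      using comp by (intro sum_mono) simp
    finally show ?thesis
      by simp
  qed
qed

text \<open>The epoch is tuned for horizon \<open>s\<close>, but \<open>e\<close> may be any of its
  rounds, so complete and truncated epochs are treated alike. \<open>P t\<close> stands for the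
  weighted previous constraint at \<open>x t\<close>. The weights \<open>\<gamma>\<close> are only
  required to be positive, nonincreasing and small enough, which fits both cases.
  \<open>xs_prev\<close> is there because the path starts with the jump from the round before the
  epoch.\<close>

locale vqb_epoch =
  fixes X :: "'v::real_inner set" and f df
    and g :: "nat \<Rightarrow> 'v \<Rightarrow> real ^ 'k" and dg
    and R F G :: real and T :: nat
    and xs x :: "nat \<Rightarrow> 'v" and L P :: "nat \<Rightarrow> real ^ 'k"
    and \<gamma> :: "nat \<Rightarrow> real" and s e :: nat
  assumes problem: "online_problem X f df g dg R F G T"
    and R_pos: "0 < R"
    and range: "1 \<le> s" "s \<le> e" "e < 2 * s" "e \<le> T"
    and xs_feasible: "\<And>t. t \<in> {s..e} \<Longrightarrow> xs t \<in> feasible X (g t)"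
    and xs_prev: "xs (s - 1) \<in> X"
    and \<gamma>_pos: "\<And>t. t \<in> {s..e} \<Longrightarrow> 0 < \<gamma> t"
    and \<gamma>_antimono: "\<And>t. t \<in> {s..<e} \<Longrightarrow> \<gamma> (t + 1) \<le> \<gamma> t"
    and \<gamma>_bound: "\<And>t. t \<in> {s..e} \<Longrightarrow> (real CARD('k) * G * \<gamma> t)\<^sup>2 \<le> 1 / (2 * sqrt (2 * R))"
    and x_start: "x s \<in> X" and L_start: "L s = 0" and P_start: "P s = 0"
    and P_step: "\<And>t. t \<in> {s..<e} \<Longrightarrow> P (t + 1) = \<gamma> t *\<^sub>R g t (x (t + 1))"
    and L_step: "\<And>t. t \<in> {s..<e} \<Longrightarrow>
          L (t + 1) = (\<chi> k. max (L t $ k + P (t + 1) $ k) (- P (t + 1) $ k))"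
    and x_step: "\<And>t. t \<in> {s..<e} \<Longrightarrow> is_arg_min
          (\<lambda>y. df t (x t) \<bullet> (y - x t) + (L t + P t) \<bullet> (\<gamma> t *\<^sub>R g t y)
            + sqrt (real s / (R + (\<Sum>r=s..t. norm (xs r - xs (r - 1))))) * (norm (y - x t))\<^sup>2)
          (\<lambda>y. y \<in> X) (x (t + 1))"
begin

section \<open>Path of the optima, proximal weight and error term of an epoch\<close>

definition path :: "nat \<Rightarrow> real" where
  "path t = (\<Sum>r=s..t. norm (xs r - xs (r - 1)))"

definition \<alpha> :: "nat \<Rightarrow> real" where
  "\<alpha> t = sqrt (real s / (R + path t))"

definition drift_error :: real where
  "drift_error = (\<Sum>t=s..<e. (norm (\<gamma> t *\<^sub>R g t (x t) - P t))\<^sup>2)"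

lemma in_horizon: "t \<in> {s..e} \<Longrightarrow> t \<in> {1..T}"
  using range by auto

lemma F_nonneg: "0 \<le> F"
  using online_problemD(3)[OF problem in_horizon x_start, of s] range by fastforce

lemma xs_in: "t \<in> {s..e} \<Longrightarrow> xs t \<in> X"
  using xs_feasible by (auto simp: feasible_def)

lemma round_cases:
  assumes "t \<in> {s..e}"
  obtains "t = s" | u where "u \<in> {s..<e}" "t = u + 1"
  using that(1) that(2)[of "t - 1"] assms by (cases "t = s") auto

lemma x_in: "t \<in> {s..e} \<Longrightarrow> x t \<in> X"
  by (elim round_cases) (use x_start x_step in \<open>auto simp: is_arg_min_def\<close>)

lemma path_nonneg: "0 \<le> path t"
  by (simp add: path_def sum_nonneg)

lemma path_Suc: "s \<le> t \<Longrightarrow> path (t + 1) = path t + norm (xs (t + 1) - xs t)"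
  by (simp add: path_def)

lemma path_mono: "t \<le> u \<Longrightarrow> path t \<le> path u"
  unfolding path_def by (rule sum_mono2) auto

lemma path_le: "t \<in> {s..e} \<Longrightarrow> path t \<le> R * real s"
proof -
  assume t: "t \<in> {s..e}"
  have "path t \<le> (\<Sum>r=s..t. R)"
    unfolding path_def
  proof (rule sum_mono)
    fix r assume "r \<in> {s..t}"
    then have "xs r \<in> X" "xs (r - 1) \<in> X"
      using t xs_in[of r] xs_in[of "r - 1"] xs_prev by (cases "r = s"; force)+
    then show "norm (xs r - xs (r - 1)) \<le> R"
      by (rule online_problemD(2)[OF problem])
  qed
  also have "\<dots> = R * real (t + 1 - s)"
    using t by simp
  also have "\<dots> \<le> R * real s"
    using t range R_pos by (intro mult_left_mono) auto
  finally show ?thesis .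
qed

lemma \<alpha>_pos: "0 < \<alpha> t"
  using R_pos range path_nonneg[of t] by (simp add: \<alpha>_def)

lemma \<alpha>_antimono: "t \<le> u \<Longrightarrow> \<alpha> u \<le> \<alpha> t"
  unfolding \<alpha>_def using R_pos path_nonneg[of t] path_mono[of t u]
  by (intro real_sqrt_le_mono divide_left_mono) (auto intro!: mult_pos_pos)

text \<open>Origin of the constant in \<open>\<gamma>\<close>: an epoch has at most \<open>s\<close>
  rounds, so \<open>R + path t\<close> is at most \<open>2 * R * s\<close> and
  \<open>\<alpha> t\<close> is never below \<open>1 / sqrt (2 * R)\<close>.\<close>

lemma step_size_le: "t \<in> {s..e} \<Longrightarrow> (real CARD('k) * G * \<gamma> t)\<^sup>2 \<le> \<alpha> t / 2"
proof -
  assume t: "t \<in> {s..e}"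
  have "R \<le> R * real s"
    using R_pos range by simp
  then have "R + path t \<le> 2 * R * real s"
    using path_le[OF t] by linarith
  then have "1 / (2 * R) \<le> real s / (R + path t)"
    using R_pos path_nonneg[of t] by (simp add: field_simps)
  then have "1 / sqrt (2 * R) \<le> \<alpha> t"
    unfolding \<alpha>_def by (metis real_sqrt_divide real_sqrt_le_iff real_sqrt_one)
  then show ?thesis
    using \<gamma>_bound[OF t] by simp
qed

section \<open>Signs and norms of the dual variable\<close>

lemma L_nonneg: "t \<in> {s..e} \<Longrightarrow> 0 \<le> L t $ k"
proof -
  assume "t \<in> {s..e}"
  then have "s \<le> t" "t \<le> e"
    by auto
  then show ?thesis
  proof (induction t rule: dec_induct)
    case (step t)
    then show ?case
      using L_step[of t] dual_update_nonneg[of "L t" k "P (t + 1)"] by simp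
  qed (simp add: L_start)
qed

text \<open>Lets the dual term absorb the boundary term \<open>- (norm (P e))\<^sup>2 / 2\<close>
  left by telescoping.\<close>

lemma P_le_L: "t \<in> {s..e} \<Longrightarrow> norm (P t) \<le> norm (L t)"
proof (elim round_cases)
  fix u assume u: "u \<in> {s..<e}" "t = u + 1"
  then show ?thesis
    using L_step[of u] dual_update_norm[of "L u" "P t", OF L_nonneg] by simp
qed (simp add: P_start L_start)

text \<open>The second branch of the maximum in the update exists for this. It makes the objective
  convex and gives the constraint term of the feasible comparator the right sign.\<close>

lemma weight_nonneg: "t \<in> {s..e} \<Longrightarrow> 0 \<le> (L t + P t) $ k"
proof (elim round_cases)
  fix u assume "u \<in> {s..<e}" "t = u + 1"
  then show ?thesis
    using L_step[of u] dual_update_ge(2)[of "P t" k "L u"] by simp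
qed (simp add: P_start L_start)

lemma objective_convex:
  assumes t: "t \<in> {s..e}"
  shows "convex_on X (\<lambda>y. df t (x t) \<bullet> (y - x t) + (L t + P t) \<bullet> (\<gamma> t *\<^sub>R g t y))"
proof (rule convex_on_add)
  note conv = online_problemD(1,6)[OF problem]
  show "convex_on X (\<lambda>y. df t (x t) \<bullet> (y - x t))"
    by (intro convex_onI conv) (simp add: inner_simps algebra_simps)
  have comp: "convex_on X (\<lambda>y. ((L t + P t) $ k * \<gamma> t) * g t y $ k)" for k
    using weight_nonneg[OF t, of k] \<gamma>_pos[OF t] in_horizon[OF t]
    by (intro convex_on_cmul conv mult_nonneg_nonneg) auto
  have "convex_on X (\<lambda>y. \<Sum>k\<in>A. ((L t + P t) $ k * \<gamma> t) * g t y $ k)" if "finite A" for A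
    using that
  proof (induction A)
    case (insert a A)
    then show ?case
      using convex_on_add[OF comp insert.IH] by simp
  qed (simp add: convex_on_def conv)
  from this[of UNIV] show "convex_on X (\<lambda>y. (L t + P t) \<bullet> (\<gamma> t *\<^sub>R g t y))"
    by (simp add: inner_vec_def mult.assoc)
qed

text \<open>The term \<open>\<alpha> t * d\<^sup>2\<close> gained from the proximal step is spent
  exactly: one half on the linear loss term by Young's inequality, the other half on
  \<open>(norm (p - q))\<^sup>2 / 2\<close>.\<close>

lemma round_bound:
  assumes "t \<in> {s..<e}"
  shows "f t (x t) - f t (xs t) + ((norm (L (t + 1)))\<^sup>2 - (norm (L t))\<^sup>2) / 2
           - ((norm (P (t + 1)))\<^sup>2 - (norm (P t))\<^sup>2) / 2
         \<le> G\<^sup>2 / (2 * \<alpha> t) + \<alpha> t * ((norm (xs t - x t))\<^sup>2 - (norm (xs t - x (t + 1)))\<^sup>2)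
           + (norm (\<gamma> t *\<^sub>R g t (x t) - P t))\<^sup>2"
proof -
  have t: "t \<in> {s..e}" "t + 1 \<in> {s..e}" "t \<in> {1..T}"
    using assms in_horizon by auto
  define d where "d = norm (x (t + 1) - x t)"
  define p where "p = P (t + 1)"
  define q where "q = P t"
  define l where "l = L t"
  define h where "h = \<gamma> t *\<^sub>R g t (x t)"
  have p: "p = \<gamma> t *\<^sub>R g t (x (t + 1))"
    using P_step[OF assms] by (simp add: p_def)
  have "df t (x t) \<bullet> (x (t + 1) - x t) + (l + q) \<bullet> p + \<alpha> t * d\<^sup>2
      \<le> df t (x t) \<bullet> (xs t - x t) + (l + q) \<bullet> (\<gamma> t *\<^sub>R g t (xs t))
        + \<alpha> t * (norm (xs t - x t))\<^sup>2 - \<alpha> t * (norm (xs t - x (t + 1)))\<^sup>2"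
    using arg_min_proximal_step[OF objective_convex[OF t(1)] _ xs_in[OF t(1)], of "\<alpha> t"] x_step[OF assms]
    unfolding \<alpha>_def path_def p l_def q_def d_def by blast
  moreover have "(l + q) \<bullet> (\<gamma> t *\<^sub>R g t (xs t)) \<le> 0"
    unfolding inner_vec_def l_def q_def
  proof (rule sum_nonpos)
    fix k
    have "\<gamma> t * g t (xs t) $ k \<le> 0"
      using xs_feasible[OF t(1)] \<gamma>_pos[OF t(1)] by (auto simp: feasible_def intro: mult_nonneg_nonpos)
    then show "(L t + P t) $ k \<bullet> (\<gamma> t *\<^sub>R g t (xs t)) $ k \<le> 0"
      using weight_nonneg[OF t(1), of k] by (auto simp: mult_nonneg_nonpos)
  qed
  moreover have "f t (x t) + df t (x t) \<bullet> (xs t - x t) \<le> f t (xs t)"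
    by (intro online_problemD(7)[OF problem] t x_in xs_in)
  moreover have "- (df t (x t) \<bullet> (x (t + 1) - x t)) \<le> G\<^sup>2 / (2 * \<alpha> t) + \<alpha> t / 2 * d\<^sup>2"
  proof -
    have "- (df t (x t) \<bullet> (x (t + 1) - x t)) \<le> norm (df t (x t)) * d"
      using Cauchy_Schwarz_ineq2[of "df t (x t)" "x (t + 1) - x t"] by (simp add: d_def)
    also have "\<dots> \<le> G * d"
      using online_problemD(5)[OF problem t(3) x_in[OF t(1)]] by (intro mult_right_mono) (auto simp: d_def)
    also have "\<dots> \<le> G\<^sup>2 / (2 * \<alpha> t) + \<alpha> t / 2 * d\<^sup>2"
    proof -
      have "0 \<le> (G - \<alpha> t * d)\<^sup>2"
        by simp
      then show ?thesis
        using \<alpha>_pos[of t] by (simp add: field_simps power2_eq_square)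
    qed
    finally show ?thesis .
  qed
  moreover have "(norm (L (t + 1)))\<^sup>2 \<le> (norm l)\<^sup>2 + 2 * (l \<bullet> p) + 2 * (norm p)\<^sup>2"
    using dual_update_drift[of l p] L_step[OF assms] by (simp add: l_def p_def)
  moreover have "2 * (q \<bullet> p) = (norm q)\<^sup>2 + (norm p)\<^sup>2 - (norm (p - q))\<^sup>2"
    by (simp add: power2_norm_eq_inner inner_simps inner_commute)
  \<comment> \<open>Insert \<open>h\<close>: \<open>p\<close> and \<open>h\<close> are one function
    at two points, which is a Lipschitz estimate, while for \<open>t > s\<close> the vectors
    \<open>h\<close> and \<open>q\<close> are consecutive functions, each with its own weight, at
    the one point \<open>x t\<close>.\<close>
  moreover have "(norm (p - q))\<^sup>2 \<le> \<alpha> t * d\<^sup>2 + 2 * (norm (h - q))\<^sup>2"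
  proof -
    have "norm (p - h) = \<gamma> t * norm (g t (x (t + 1)) - g t (x t))"
      using \<gamma>_pos[OF t(1)] by (simp add: p h_def flip: scaleR_diff_right)
    also have "\<dots> \<le> \<gamma> t * (real CARD('k) * G * d)"
      unfolding d_def using \<gamma>_pos[OF t(1)] t
      by (intro mult_left_mono online_problemD(8)[OF problem] x_in) auto
    finally have "(norm (p - h))\<^sup>2 \<le> (real CARD('k) * G * \<gamma> t * d)\<^sup>2"
      by (intro power_mono) (auto simp: mult_ac)
    also have "\<dots> \<le> \<alpha> t / 2 * d\<^sup>2"
      unfolding power_mult_distrib[of _ d] using step_size_le[OF t(1)] by (intro mult_right_mono) auto
    finally have "(norm (p - h))\<^sup>2 \<le> \<alpha> t / 2 * d\<^sup>2" .
    moreover have "(norm (p - q))\<^sup>2 \<le> 2 * (norm (p - h))\<^sup>2 + 2 * (norm (h - q))\<^sup>2"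
    proof -
      have "norm (p - q) \<le> norm (p - h) + norm (h - q)"
        using norm_triangle_ineq[of "p - h" "h - q"] by simp
      then have "(norm (p - q))\<^sup>2 \<le> (norm (p - h) + norm (h - q))\<^sup>2"
        by (intro power_mono) auto
      also have "\<dots> \<le> 2 * (norm (p - h))\<^sup>2 + 2 * (norm (h - q))\<^sup>2"
        using sum_squares_bound[of "norm (p - h)" "norm (h - q)"] by (simp add: power2_sum)
      finally show ?thesis .
    qed
    ultimately show ?thesis
      by simp
  qed
  ultimately show ?thesis
    unfolding p_def[symmetric] q_def[symmetric] l_def[symmetric] h_def[symmetric]
    by (simp add: inner_add_left inner_add_right algebra_simps) argo
qed

text \<open>Telescoping would need the distance of \<open>x (t + 1)\<close> to the next optimum.
  Replacing the optimum changes the square by at most \<open>2 * R\<close> times the jump. In the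
  constant, 6 = 2 * 3 with the 3 from \<open>increment_div_sqrt_le\<close>, and 1 comes from the
  boundary term \<open>\<alpha> s * R\<^sup>2\<close>.\<close>

lemma sum_alpha_le: "(\<Sum>t=s..<e. \<alpha> t * ((norm (xs t - x t))\<^sup>2 - (norm (xs t - x (t + 1)))\<^sup>2))
    \<le> 7 * R * sqrt (real s * (R + path e))"
proof -
  define b where "b = (\<lambda>t. (norm (xs t - x t))\<^sup>2)"
  define w where "w = (\<lambda>t. sqrt (R + path t))"
  have diam: "norm (y - z) \<le> R" if "y \<in> X" "z \<in> X" for y z
    using online_problemD(2)[OF problem that] .
  have shift: "\<alpha> t * (b (t + 1) - (norm (xs t - x (t + 1)))\<^sup>2) \<le> 6 * R * sqrt (real s) * (w (t + 1) - w t)"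
    if "t \<in> {s..<e}" for t
  proof -
    have t: "xs t \<in> X" "xs (t + 1) \<in> X" "x (t + 1) \<in> X"
      using that by (auto intro!: xs_in x_in)
    define c where "c = norm (xs (t + 1) - xs t)"
    define u v where "u = norm (xs (t + 1) - x (t + 1))" and "v = norm (xs t - x (t + 1))"
    have uv: "0 \<le> u" "0 \<le> v" "u \<le> R" "v \<le> R" "0 \<le> c" "c \<le> R"
      unfolding u_def v_def c_def using t by (auto intro: diam)
    have "u - v \<le> c"
      using norm_triangle_ineq2[of "xs (t + 1) - x (t + 1)" "xs t - x (t + 1)"] by (simp add: u_def v_def c_def)
    have "u\<^sup>2 - v\<^sup>2 = (u + v) * (u - v)"
      by (simp add: power2_eq_square algebra_simps)
    also have "\<dots> \<le> (u + v) * c"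
      using \<open>u - v \<le> c\<close> uv by (intro mult_left_mono) auto
    also have "\<dots> \<le> (2 * R) * c"
      using uv by (intro mult_right_mono) auto
    finally have "\<alpha> t * (u\<^sup>2 - v\<^sup>2) \<le> \<alpha> t * ((2 * R) * c)"
      using \<alpha>_pos[of t] by (intro mult_left_mono) auto
    also have "\<dots> = (2 * R * sqrt (real s)) * (c / sqrt (R + path t))"
      by (simp add: \<alpha>_def real_sqrt_divide)
    also have "\<dots> \<le> (2 * R * sqrt (real s)) * (3 * (w (t + 1) - w t))"
    proof (rule mult_left_mono)
      have "path (t + 1) = path t + c"
        using that path_Suc[of t] by (simp add: c_def)
      then show "c / sqrt (R + path t) \<le> 3 * (w (t + 1) - w t)"
        using increment_div_sqrt_le[of c "R + path t"] uv R_pos path_nonneg[of t] by (simp add: w_def add.assoc)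
    qed (use R_pos in simp)
    finally show ?thesis
      by (simp add: b_def u_def v_def algebra_simps)
  qed
  have "(\<Sum>t=s..<e. \<alpha> t * ((norm (xs t - x t))\<^sup>2 - (norm (xs t - x (t + 1)))\<^sup>2))
      = (\<Sum>t=s..<e. \<alpha> t * (b t - b (t + 1)))
        + (\<Sum>t=s..<e. \<alpha> t * (b (t + 1) - (norm (xs t - x (t + 1)))\<^sup>2))"
    by (simp add: b_def algebra_simps flip: sum.distrib)
  also have "\<dots> \<le> \<alpha> s * R\<^sup>2 + (\<Sum>t=s..<e. 6 * R * sqrt (real s) * (w (t + 1) - w t))"
  proof (intro add_mono sum_mono shift sum_weighted_telescope_le range \<alpha>_antimono)
    show "0 \<le> \<alpha> t \<and> 0 \<le> b t \<and> b t \<le> R\<^sup>2" if "t \<in> {s..e}" for t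
      using \<alpha>_pos[of t] diam[OF xs_in x_in, OF that that] by (simp add: b_def power_mono)
  qed auto
  also have "(\<Sum>t=s..<e. 6 * R * sqrt (real s) * (w (t + 1) - w t)) = 6 * R * sqrt (real s) * (w e - w s)"
    using sum_Suc_diff'[OF range(2), of w] by (simp flip: sum_distrib_left)
  also have "\<dots> \<le> 6 * R * sqrt (real s) * w e"
    using R_pos path_nonneg[of s] by (intro mult_left_mono) (auto simp: w_def)
  also have "\<alpha> s * R\<^sup>2 \<le> R * sqrt (real s) * w e"
  proof -
    have "\<alpha> s * R \<le> sqrt (real s) * w e"
    proof -
      have "R = sqrt R * sqrt R"
        using R_pos by simp
      also have "\<dots> \<le> w s * w e"
        using R_pos path_nonneg[of s] path_nonneg[of e] unfolding w_def by (intro mult_mono) auto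
      finally have "\<alpha> s * R \<le> \<alpha> s * (w s * w e)"
        using \<alpha>_pos[of s] by (intro mult_left_mono) auto
      also have "\<dots> = sqrt (real s) * w e"
        using R_pos path_nonneg[of s] by (simp add: \<alpha>_def w_def real_sqrt_divide)
      finally show ?thesis .
    qed
    from mult_left_mono[OF this, of R] show ?thesis
      using R_pos by (simp add: power2_eq_square mult_ac)
  qed
  finally show ?thesis
    by (simp add: w_def real_sqrt_mult)
qed

text \<open>\<open>s / \<alpha> e\<close> has the same order as the bound of
  \<open>sum_alpha_le\<close>: \<open>\<alpha>\<close> is chosen to balance the two sums.\<close>

lemma sum_inverse_alpha_le: "(\<Sum>t=s..<e. G\<^sup>2 / (2 * \<alpha> t)) \<le> G\<^sup>2 / 2 * sqrt (real s * (R + path e))"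
proof -
  have "(\<Sum>t=s..<e. G\<^sup>2 / (2 * \<alpha> t)) \<le> (\<Sum>t=s..<e. G\<^sup>2 / (2 * \<alpha> e))"
    using \<alpha>_pos \<alpha>_antimono by (intro sum_mono divide_left_mono) (auto intro!: mult_pos_pos)
  also have "\<dots> = real (e - s) * (G\<^sup>2 / (2 * \<alpha> e))"
    by simp
  also have "\<dots> \<le> real s * (G\<^sup>2 / (2 * \<alpha> e))"
    using range \<alpha>_pos[of e] by (intro mult_right_mono) auto
  also have "\<dots> = G\<^sup>2 / 2 * (real s / \<alpha> e)"
    by simp
  also have "real s / \<alpha> e = real s / sqrt (real s) * sqrt (R + path e)"
    by (simp add: \<alpha>_def real_sqrt_divide)
  also have "\<dots> = sqrt (real s * (R + path e))"
    by (simp add: real_div_sqrt real_sqrt_mult)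
  finally show ?thesis .
qed

section \<open>The summed round inequality, read as a regret bound and as a bound on the dual
  variable\<close>

lemma drift_plus_regret:
  "(\<Sum>t=s..<e. f t (x t) - f t (xs t)) + (norm (L e))\<^sup>2 / 2 - (norm (P e))\<^sup>2 / 2
     \<le> (G\<^sup>2 / 2 + 7 * R) * sqrt (real s * (R + path e)) + drift_error"
proof -
  have tel: "(\<Sum>t=s..<e. (norm (M (t + 1)))\<^sup>2 - (norm (M t))\<^sup>2) = (norm (M e))\<^sup>2 - (norm (M s))\<^sup>2"
    for M :: "nat \<Rightarrow> real ^ 'k"
    using sum_Suc_diff'[OF range(2), of "\<lambda>t. (norm (M t))\<^sup>2"] by simp
  have "(\<Sum>t=s..<e. f t (x t) - f t (xs t)) + (norm (L e))\<^sup>2 / 2 - (norm (P e))\<^sup>2 / 2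
      = (\<Sum>t=s..<e. f t (x t) - f t (xs t) + ((norm (L (t + 1)))\<^sup>2 - (norm (L t))\<^sup>2) / 2
           - ((norm (P (t + 1)))\<^sup>2 - (norm (P t))\<^sup>2) / 2)"
    using tel[of L] tel[of P]
    by (simp add: sum.distrib sum_subtractf L_start P_start flip: sum_divide_distrib)
  also have "\<dots> \<le> (\<Sum>t=s..<e. G\<^sup>2 / (2 * \<alpha> t)
      + \<alpha> t * ((norm (xs t - x t))\<^sup>2 - (norm (xs t - x (t + 1)))\<^sup>2)
      + (norm (\<gamma> t *\<^sub>R g t (x t) - P t))\<^sup>2)"
    by (intro sum_mono round_bound)
  also have "\<dots> \<le> (G\<^sup>2 / 2 + 7 * R) * sqrt (real s * (R + path e)) + drift_error"
    unfolding sum.distrib drift_error_def distrib_right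
    by (intro add_mono sum_inverse_alpha_le sum_alpha_le order_refl)
  finally show ?thesis .
qed

lemma round_regret_bounds:
  assumes "t \<in> {s..e}"
  shows "\<bar>f t (x t) - f t (xs t)\<bar> \<le> 2 * F"
  using online_problemD(3)[OF problem in_horizon[OF assms] x_in[OF assms]]
    online_problemD(3)[OF problem in_horizon[OF assms] xs_in[OF assms]] by linarith

lemma epoch_regret:
  "(\<Sum>t=s..e. f t (x t) - f t (xs t))
     \<le> 2 * F + (G\<^sup>2 / 2 + 7 * R) * sqrt (real s * (R + path e)) + drift_error"
proof -
  have "(\<Sum>t=s..e. f t (x t) - f t (xs t)) = (\<Sum>t=s..<e. f t (x t) - f t (xs t)) + (f e (x e) - f e (xs e))"
    using range(2) by (simp add: sum.last_plus)
  moreover have "(norm (P e))\<^sup>2 \<le> (norm (L e))\<^sup>2"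
    using P_le_L[of e] range by (intro power_mono) auto
  moreover have "\<bar>f e (x e) - f e (xs e)\<bar> \<le> 2 * F"
    using round_regret_bounds[of e] range by simp
  ultimately show ?thesis
    using drift_plus_regret by linarith
qed

lemma dual_bound:
  "(norm (L e))\<^sup>2 \<le> 4 * F * real s
     + 2 * (G\<^sup>2 / 2 + 7 * R) * sqrt (real s * (R + path e)) + 2 * drift_error + (norm (P e))\<^sup>2"
proof -
  have "- (2 * F * real s) \<le> - (2 * F * real (e - s))"
    using range F_nonneg by (auto intro: mult_left_mono)
  also have "\<dots> = (\<Sum>t=s..<e. - (2 * F))"
    by simp
  also have "\<dots> \<le> (\<Sum>t=s..<e. f t (x t) - f t (xs t))"
  proof (rule sum_mono)
    show "- (2 * F) \<le> f t (x t) - f t (xs t)" if "t \<in> {s..<e}" for t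
      using round_regret_bounds[of t] that by auto
  qed
  finally show ?thesis
    using drift_plus_regret by (simp add: algebra_simps)
qed

text \<open>The dual variable accumulates \<open>g (t - 1)\<close> at \<open>x t\<close>, one round
  late. Correcting the index costs the differences of consecutive constraints, and the first round,
  which has no predecessor, costs \<open>F\<close>.\<close>

lemma epoch_violation:
  "(\<Sum>t=s..e. g t (x t) $ k) \<le> F + norm (L e) / \<gamma> e + (\<Sum>t=s+1..e. norm (g t (x t) - g (t - 1) (x t)))"
proof -
  \<comment> \<open>With varying \<open>\<gamma>\<close> the quotient by the current weight is the
    right invariant: since \<open>L\<close> is nonnegative, a smaller weight only enlarges
    it.\<close>
  have queue: "(\<Sum>t=s..<m. g t (x (t + 1)) $ k) \<le> L m $ k / \<gamma> m" if "s \<le> m" "m \<le> e" for m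
    using that
  proof (induction m rule: dec_induct)
    case base
    then show ?case
      by (simp add: L_start)
  next
    case (step m)
    then have m: "m \<in> {s..e}" "m \<in> {s..<e}" "m + 1 \<in> {s..e}"
      by auto
    have "L m $ k + \<gamma> m * g m (x (m + 1)) $ k \<le> L (m + 1) $ k"
      using dual_update_ge(1)[of "L m" k "P (m + 1)"] L_step[OF m(2)] P_step[OF m(2)] by simp
    then have "L m $ k / \<gamma> m + g m (x (m + 1)) $ k \<le> L (m + 1) $ k / \<gamma> m"
      using \<gamma>_pos[OF m(1)] by (simp add: pos_le_divide_eq distrib_left mult.commute[of _ "\<gamma> m"])
    also have "\<dots> \<le> L (m + 1) $ k / \<gamma> (m + 1)"
      using \<gamma>_pos[OF m(1)] \<gamma>_pos[OF m(3)] \<gamma>_antimono[OF m(2)] L_nonneg[OF m(3)]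
      by (intro divide_left_mono) auto
    finally show ?case
      using step m by simp
  qed
  have "(\<Sum>t=s..e. g t (x t) $ k) = g s (x s) $ k + (\<Sum>t=s+1..e. g t (x t) $ k)"
    using range(2) by (simp add: sum.atLeast_Suc_atMost)
  also have "(\<Sum>t=s+1..e. g t (x t) $ k)
      = (\<Sum>t=s+1..e. g (t - 1) (x t) $ k) + (\<Sum>t=s+1..e. (g t (x t) - g (t - 1) (x t)) $ k)"
    by (simp flip: sum.distrib)
  also have "(\<Sum>t=s+1..e. g (t - 1) (x t) $ k) = (\<Sum>t=s..<e. g t (x (t + 1)) $ k)"
    by (rule sum.reindex_bij_witness[of _ "\<lambda>t. t + 1" "\<lambda>t. t - 1"]) auto
  also have "g s (x s) $ k + ((\<Sum>t=s..<e. g t (x (t + 1)) $ k)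
      + (\<Sum>t=s+1..e. (g t (x t) - g (t - 1) (x t)) $ k))
    \<le> F + (norm (L e) / \<gamma> e + (\<Sum>t=s+1..e. norm (g t (x t) - g (t - 1) (x t))))"
  proof (intro add_mono sum_mono)
    have "g s (x s) $ k \<le> norm (g s (x s))"
      using component_le_norm_cart[of "g s (x s)" k] by simp
    then show "g s (x s) $ k \<le> F"
      using online_problemD(4)[OF problem in_horizon x_start] range by fastforce
    have "L e $ k / \<gamma> e \<le> norm (L e) / \<gamma> e"
      using component_le_norm_cart[of "L e" k] \<gamma>_pos[of e] range by (intro divide_right_mono) auto
    then show "(\<Sum>t=s..<e. g t (x (t + 1)) $ k) \<le> norm (L e) / \<gamma> e"
      using queue[of e] range by simp
    show "(g t (x t) - g (t - 1) (x t)) $ k \<le> norm (g t (x t) - g (t - 1) (x t))" for t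
      using component_le_norm_cart[of "g t (x t) - g (t - 1) (x t)" k] by simp
  qed
  finally show ?thesis
    by simp
qed

text \<open>Only the weights of rounds \<open>t\<close> and \<open>t - 1\<close> are compared with
  \<open>c\<close>, so that \<open>c\<close> may depend on \<open>t\<close> when
  \<open>\<gamma>\<close> decreases.\<close>

lemma P_norm_le:
  assumes c: "\<And>u. u \<in> {s..t} \<Longrightarrow> t \<le> u + 1 \<Longrightarrow> (\<gamma> u)\<^sup>2 \<le> c" and t: "t \<in> {s..e}"
  shows "norm (P t) \<le> sqrt c * F"
proof -
  have c0: "0 \<le> c"
    using order_trans[OF zero_le_power2 c[of t]] t by simp
  from t show ?thesis
  proof (elim round_cases)
    assume "t = s"
    then show ?thesis
      using c0 by (simp add: P_start F_nonneg)
  next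
    fix u assume u: "u \<in> {s..<e}" "t = u + 1"
    then have "u \<in> {s..e}"
      by simp
    moreover from this have "\<gamma> u \<le> sqrt c" "0 < \<gamma> u"
      using c[of u] u \<gamma>_pos by (auto intro: real_le_rsqrt)
    ultimately show ?thesis
      using P_step[OF u(1)] online_problemD(4)[OF problem in_horizon x_in[OF t], of u] u c0
      by (auto intro!: mult_mono)
  qed
qed

lemma drift_term_le:
  assumes c: "\<And>u. u \<in> {s..t} \<Longrightarrow> t \<le> u + 1 \<Longrightarrow> (\<gamma> u)\<^sup>2 \<le> c" and t: "t \<in> {s..e}"
  shows "(norm (\<gamma> t *\<^sub>R g t (x t) - P t))\<^sup>2 \<le> 4 * F\<^sup>2 * c"
proof -
  have "\<gamma> t \<le> sqrt c" "0 < \<gamma> t" "0 \<le> c"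
    using c[of t] t \<gamma>_pos[OF t] by (auto intro: real_le_rsqrt order_trans[OF zero_le_power2])
  then have "norm (\<gamma> t *\<^sub>R g t (x t)) \<le> sqrt c * F"
    using online_problemD(4)[OF problem in_horizon[OF t] x_in[OF t]] by (auto intro!: mult_mono)
  then have "norm (\<gamma> t *\<^sub>R g t (x t) - P t) \<le> sqrt c * F + sqrt c * F"
    using P_norm_le[OF c t] norm_triangle_ineq4[of "\<gamma> t *\<^sub>R g t (x t)" "P t"] by linarith
  then have "(norm (\<gamma> t *\<^sub>R g t (x t) - P t))\<^sup>2 \<le> (2 * F * sqrt c)\<^sup>2"
    by (intro power_mono) (auto simp: mult_ac)
  then show ?thesis
    using \<open>0 \<le> c\<close> by (simp add: power_mult_distrib)
qed

text \<open>No lower bound on the regret is available because the iterates may be infeasible; the crude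
  bound \<open>- 2 F\<close> per round still keeps the dual variable of order \<open>sqrt s\<close>.\<close>

lemma dual_norm_le:
  assumes c: "\<And>t. t \<in> {s..e} \<Longrightarrow> (\<gamma> t)\<^sup>2 \<le> c"
  shows "norm (L e) \<le> sqrt (4 * F + 2 * (G\<^sup>2 / 2 + 7 * R) * sqrt (2 * R) + 9 * F\<^sup>2 * c) * sqrt (real s)"
proof -
  have e: "e \<in> {s..e}"
    using range by simp
  have c0: "0 \<le> c"
    using c[OF e] zero_le_power2[of "\<gamma> e"] by linarith
  have "drift_error \<le> (\<Sum>t=s..<e. 4 * F\<^sup>2 * c)"
    unfolding drift_error_def by (intro sum_mono drift_term_le c) auto
  also have "\<dots> = real (e - s) * (4 * F\<^sup>2 * c)"
    by simp
  also have "\<dots> \<le> real s * (4 * F\<^sup>2 * c)"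
    using range c0 by (intro mult_right_mono) auto
  finally have err: "drift_error \<le> real s * (4 * F\<^sup>2 * c)" .
  have "(norm (P e))\<^sup>2 \<le> (sqrt c * F)\<^sup>2"
    by (intro power_mono P_norm_le c e) auto
  also have "\<dots> \<le> real s * (F\<^sup>2 * c)"
    using range c0 mult_right_mono[of 1 "real s" "F\<^sup>2 * c"] by (simp add: power_mult_distrib mult.commute)
  finally have P: "(norm (P e))\<^sup>2 \<le> real s * (F\<^sup>2 * c)" .
  have "R \<le> R * real s"
    using R_pos range by simp
  then have "R + path e \<le> 2 * R * real s"
    using path_le[OF e] by linarith
  then have "real s * (R + path e) \<le> 2 * R * (real s)\<^sup>2"
    using mult_left_mono[of "R + path e" "2 * R * real s" "real s"] by (simp add: power2_eq_square mult_ac)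
  then have "sqrt (real s * (R + path e)) \<le> sqrt (2 * R * (real s)\<^sup>2)"
    by (rule real_sqrt_le_mono)
  also have "\<dots> = sqrt (2 * R) * real s"
    by (simp add: real_sqrt_mult)
  finally have "(G\<^sup>2 / 2 + 7 * R) * sqrt (real s * (R + path e)) \<le> (G\<^sup>2 / 2 + 7 * R) * (sqrt (2 * R) * real s)"
    using R_pos by (intro mult_left_mono) auto
  \<comment> \<open>The coefficient 9 is 2 * 4 from \<open>2 * drift_error\<close> plus 1 from
    \<open>(norm (P e))\<^sup>2\<close>.\<close>
  then have "(norm (L e))\<^sup>2
      \<le> (4 * F + 2 * (G\<^sup>2 / 2 + 7 * R) * sqrt (2 * R) + 9 * F\<^sup>2 * c) * real s"
    using dual_bound err P by (simp only: algebra_simps)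
  then show ?thesis
    by (simp add: real_le_rsqrt flip: real_sqrt_mult)
qed

end

section \<open>Doubling\<close>

text \<open>\<open>p \<ge> 1 / 2\<close> gives growth by at least 5/4 per epoch, so 4 is a constant
  that survives adding one more complete epoch, as 4 + 1 is at most 4 * \<open>2 powr p\<close>. The
  last, possibly truncated, epoch raises it to 5. The \<open>v\<close>-sums of the epochs are
  disjoint and miss only first rounds.\<close>

lemma sum_over_epochs_le:
  fixes a v :: "nat \<Rightarrow> real"
  assumes nonneg: "0 \<le> A" "0 \<le> B" "\<And>t. 0 \<le> v t" and p: "1 / 2 \<le> p" and T: "1 \<le> T"
    and epoch: "\<And>i e. 2 ^ i \<le> e \<Longrightarrow> e < 2 * 2 ^ i \<Longrightarrow> e \<le> T \<Longrightarrow>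
          (\<Sum>t=2^i..e. a t) \<le> A * (2 ^ i) powr p + B * (\<Sum>t=2^i+1..e. v t)"
  shows "(\<Sum>t=1..T. a t) \<le> 5 * A * real T powr p + B * (\<Sum>t=2..T. v t)"
proof -
  have "(5 / 4)\<^sup>2 \<le> (2 :: real)"
    by (simp add: power2_eq_square)
  then have "5 / 4 \<le> sqrt 2"
    by (rule real_le_rsqrt)
  also have "sqrt 2 = 2 powr (1 / 2)"
    by (simp add: powr_half_sqrt)
  also have "\<dots> \<le> 2 powr p"
    using p by simp
  finally have growth: "5 / 4 \<le> 2 powr p" .
  have step: "(\<Sum>t=1..e. a t) \<le> C * A * (2 ^ i) powr p + A * (2 ^ i) powr p + B * (\<Sum>t=2..e. v t)"
    if before: "(\<Sum>t=1..<2^i. a t) \<le> C * A * (2 ^ i) powr p + B * (\<Sum>t=2..<2^i. v t)"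
      and e: "2 ^ i \<le> e" "e < 2 * 2 ^ i" "e \<le> T" for i e C
  proof -
    have pos: "(1::nat) \<le> 2 ^ i"
      by simp
    have "{1..e} = {1..<2^i} \<union> {2^i..e}"
      using e pos by auto
    then have "(\<Sum>t=1..e. a t) = (\<Sum>t=1..<2^i. a t) + (\<Sum>t=2^i..e. a t)"
      by (subst sum.union_disjoint[symmetric]) auto
    moreover have "(\<Sum>t=2..<2^i. v t) + (\<Sum>t=2^i+1..e. v t) \<le> (\<Sum>t=2..e. v t)"
      using e pos nonneg(3) by (subst sum.union_disjoint[symmetric]) (auto intro!: sum_mono2)
    then have "B * (\<Sum>t=2..<2^i. v t) + B * (\<Sum>t=2^i+1..e. v t) \<le> B * (\<Sum>t=2..e. v t)"
      using nonneg(2) by (simp only: mult_left_mono flip: distrib_left)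
    ultimately show ?thesis
      using before epoch[OF e] by linarith
  qed
  have before: "(\<Sum>t=1..<2^i. a t) \<le> 4 * A * (2 ^ i) powr p + B * (\<Sum>t=2..<2^i. v t)"
    if "2 ^ i \<le> T" for i
    using that
  proof (induction i)
    case 0
    then show ?case
      using nonneg by simp
  next
    case (Suc i)
    define e where "e = (2 * 2 ^ i - 1 :: nat)"
    have "(1::nat) \<le> 2 ^ i"
      by simp
    then have e: "2 ^ i \<le> e" "e < 2 * 2 ^ i" "e \<le> T"
      using Suc.prems unfolding e_def power_Suc by linarith+
    have "(\<Sum>t=1..e. a t) \<le> 4 * A * (2 ^ i) powr p + A * (2 ^ i) powr p + B * (\<Sum>t=2..e. v t)"
      using Suc by (intro step e) auto
    also have "4 * A * (2 ^ i) powr p + A * (2 ^ i) powr p \<le> 4 * A * (2 ^ Suc i) powr p"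
    proof -
      have "5 * (2 ^ i) powr p \<le> 4 * (2 powr p) * (2 ^ i) powr p"
        using growth by (intro mult_right_mono) auto
      then have "A * (5 * (2 ^ i) powr p) \<le> A * (4 * (2 powr p) * (2 ^ i) powr p)"
        using nonneg(1) by (rule mult_left_mono)
      then show ?thesis
        by (simp add: powr_mult algebra_simps)
    qed
    finally have "(\<Sum>t=1..e. a t) \<le> 4 * A * (2 ^ Suc i) powr p + B * (\<Sum>t=2..e. v t)"
      by simp
    moreover have "{1..e} = {1..<2 ^ Suc i}" "{2..e} = {2..<2 ^ Suc i}"
      by (auto simp: e_def)
    ultimately show ?case
      by simp
  qed
  define i where "i = floor_log T"
  have i: "2 ^ i \<le> T" "T < 2 * 2 ^ i"
    using T floor_log_exp2_le[of T] floor_log_exp2_gt[of T] by (auto simp: i_def)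
  have "(\<Sum>t=1..T. a t) \<le> 4 * A * (2 ^ i) powr p + A * (2 ^ i) powr p + B * (\<Sum>t=2..T. v t)"
    using before i by (intro step) auto
  also have "4 * A * (2 ^ i) powr p + A * (2 ^ i) powr p \<le> 5 * A * real T powr p"
  proof -
    have "real (2 ^ i) \<le> real T"
      using i(1) by (simp only: of_nat_le_iff)
    then have "(2 ^ i) powr p \<le> real T powr p"
      using p by (intro powr_mono2) auto
    then show ?thesis
      using mult_left_mono[of _ _ "5 * A"] nonneg(1) by fastforce
  qed
  finally show ?thesis
    by simp
qed

lemma epoch_start_eq: "2 ^ i \<le> t \<Longrightarrow> t < 2 * 2 ^ i \<Longrightarrow> epoch_start t = 2 ^ i"
  by (simp add: epoch_start_def floor_log_eqI)

text \<open>\<open>c\<close> is the constant value of \<open>\<gamma>\<^sup>2\<close> in the first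
  case and an upper bound in the second. Monotonicity is asked only inside an epoch because
  decreasing weights jump back up at a reset.\<close>

locale vqb_doubling =
  fixes X :: "'v::real_inner set" and f df
    and g :: "nat \<Rightarrow> 'v \<Rightarrow> real ^ 'k" and dg
    and R F G :: real and T :: nat
    and xs x :: "nat \<Rightarrow> 'v" and \<Lambda> :: "nat \<Rightarrow> real ^ 'k"
    and \<gamma> :: "nat \<Rightarrow> real" and c :: real
  assumes problem: "online_problem X f df g dg R F G T"
    and optimal: "optimal_sequence X f g T xs"
    and run: "vqb_run X df g (step_alpha R xs) \<gamma> T x \<Lambda>"
    and R_pos: "0 < R" and G_pos: "0 < G" and T_pos: "1 \<le> T"
    and \<gamma>_pos: "\<And>t. 0 < \<gamma> t"
    and \<gamma>_antimono: "\<And>t. epoch_start (t + 1) = epoch_start t \<Longrightarrow> \<gamma> (t + 1) \<le> \<gamma> t"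
    and \<gamma>_bound: "\<And>t. (\<gamma> t)\<^sup>2 \<le> c"
    and c_def: "c = 1 / (2 * (real CARD('k) * G)\<^sup>2) * (1 / sqrt (2 * R))"
begin

definition P :: "nat \<Rightarrow> real ^ 'k" where
  "P t = prev_constraint g \<gamma> t (x t)"

text \<open>Agrees with the dual variable of the run except in the last round of an epoch, where it is the
  update that the algorithm skips.\<close>

definition L :: "nat \<Rightarrow> real ^ 'k" where
  "L t = (\<chi> k. max (\<Lambda> (t - 1) $ k + P t $ k) (- P t $ k))"

lemma epoch:
  assumes e: "2 ^ i \<le> e" "e < 2 * 2 ^ i" "e \<le> T"
  shows "vqb_epoch X f df g dg R F G T xs x L P \<gamma> (2 ^ i) e"
proof
  define s where "s = (2::nat) ^ i"
  have s1: "1 \<le> s"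
    by (simp add: s_def)
  have start: "epoch_start t = s" if "t \<in> {s..e}" for t
    using that e unfolding s_def by (intro epoch_start_eq) auto
  have start': "epoch_start (Suc t) = s" if "t \<in> {s..<e}" for t
    using start[of "Suc t"] that by simp
  have s: "s \<in> {1..T}" "x s \<in> X" "\<Lambda> (s - 1) = 0" "P s = 0"
    using run start[of s] s1 e by (auto simp: vqb_run_def s_def P_def prev_constraint_def)
  have L_start: "L s = 0"
    using s by (simp add: L_def vec_eq_iff)
  \<comment> \<open>A round before \<open>e\<close> is neither the last of its epoch nor the last
    overall, so the run does perform its update there.\<close>
  have steps: "\<Lambda> t = L t" "is_arg_min
          (\<lambda>y. df t (x t) \<bullet> (y - x t) + (\<Lambda> t + P t) \<bullet> (\<gamma> t *\<^sub>R g t y)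
            + step_alpha R xs t * (norm (y - x t))\<^sup>2) (\<lambda>y. y \<in> X) (x (t + 1))"
    if "t \<in> {s..<e}" for t
  proof -
    have t: "t \<in> {1..<T}" "t + 1 < 2 * epoch_start t"
      using that e s1 start[of t] by (auto simp: s_def)
    note * = run[unfolded vqb_run_def, THEN conjunct2, rule_format, OF t, folded P_def]
    from * show "\<Lambda> t = L t"
      by (simp add: L_def)
    from * show "is_arg_min
          (\<lambda>y. df t (x t) \<bullet> (y - x t) + (\<Lambda> t + P t) \<bullet> (\<gamma> t *\<^sub>R g t y)
            + step_alpha R xs t * (norm (y - x t))\<^sup>2) (\<lambda>y. y \<in> X) (x (t + 1))"
      by blast
  qed
  have feas: "xs t \<in> feasible X (g t)" if "t \<in> {1..T}" for t
    using optimal that by (auto simp: optimal_sequence_def is_arg_min_def)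
  show "xs t \<in> feasible X (g t)" if "t \<in> {2 ^ i..e}" for t
    using that e s1 unfolding s_def by (intro feas) auto
  \<comment> \<open>In the very first epoch this is the convention \<open>xs 0 = xs 1\<close>; later
    it is the last optimum of the previous epoch.\<close>
  show "xs (2 ^ i - 1) \<in> X"
  proof (cases "s = 1")
    case True
    then show ?thesis
      using feas[of 1] optimal T_pos by (simp add: s_def optimal_sequence_def feasible_def)
  next
    case False
    then have "s - 1 \<in> {1..T}"
      using s(1) by auto
    from feas[OF this] show ?thesis
      by (simp add: s_def feasible_def)
  qed
  show "\<gamma> (t + 1) \<le> \<gamma> t" if "t \<in> {2 ^ i..<e}" for t
    using that start[of t] start'[of t] by (intro \<gamma>_antimono) (auto simp: s_def)
  show "(real CARD('k) * G * \<gamma> t)\<^sup>2 \<le> 1 / (2 * sqrt (2 * R))" for t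
  proof -
    have "(real CARD('k) * G * \<gamma> t)\<^sup>2 \<le> (real CARD('k) * G)\<^sup>2 * c"
      unfolding power_mult_distrib[of _ "\<gamma> t"] by (intro mult_left_mono \<gamma>_bound) auto
    also have "\<dots> = 1 / (2 * sqrt (2 * R))"
      using G_pos by (simp add: c_def)
    finally show ?thesis .
  qed
  show "P (t + 1) = \<gamma> t *\<^sub>R g t (x (t + 1))" if "t \<in> {2 ^ i..<e}" for t
    using that start'[of t] by (simp add: P_def prev_constraint_def s_def)
  show "L (t + 1) = (\<chi> k. max (L t $ k + P (t + 1) $ k) (- P (t + 1) $ k))"
    if "t \<in> {2 ^ i..<e}" for t
    using steps(1)[of t] that by (simp add: L_def[of "Suc t"] s_def)
  show "is_arg_min
          (\<lambda>y. df t (x t) \<bullet> (y - x t) + (L t + P t) \<bullet> (\<gamma> t *\<^sub>R g t y)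
            + sqrt (real (2 ^ i) / (R + (\<Sum>r=2^i..t. norm (xs r - xs (r - 1))))) * (norm (y - x t))\<^sup>2)
          (\<lambda>y. y \<in> X) (x (t + 1))" if "t \<in> {2 ^ i..<e}" for t
    using steps[of t] that start[of t] by (simp add: step_alpha_def s_def)
  show "x (2 ^ i) \<in> X" "L (2 ^ i) = 0" "P (2 ^ i) = 0"
    using s L_start by (simp_all add: s_def)
qed (use problem R_pos e \<gamma>_pos in auto)

lemma F_nonneg: "0 \<le> F"
  using vqb_epoch.F_nonneg[OF epoch[of 0 1]] T_pos by simp

lemma x_in: "t \<in> {1..T} \<Longrightarrow> x t \<in> X"
  using vqb_epoch.x_in[OF epoch[of "floor_log t" t], of t]
    floor_log_exp2_le[of t] floor_log_exp2_gt[of t] by auto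

lemma c_pos: "0 < c"
  unfolding c_def using R_pos G_pos by simp

definition \<delta> :: "nat \<Rightarrow> real" where
  "\<delta> t = norm (g t (x t) - g (t - 1) (x t))"

lemma \<delta>_nonneg: "0 \<le> \<delta> t"
  by (simp add: \<delta>_def)

lemma sum_\<delta>_le: "(\<Sum>t=2..T. \<delta> t) \<le> constraint_variation X g T"
  unfolding constraint_variation_def
proof (rule sum_mono)
  fix t assume t: "t \<in> {2..T}"
  then have t': "t \<in> {1..T}" "t - 1 \<in> {1..T}"
    by auto
  have "norm (g t y - g (t - 1) y) \<le> F + F" if "y \<in> X" for y
    using online_problemD(4)[OF problem t'(1) that] online_problemD(4)[OF problem t'(2) that]
      norm_triangle_ineq4[of "g t y" "g (t - 1) y"] by linarith
  then have "bdd_above ((\<lambda>y. norm (g t y - g (t - 1) y)) ` X)"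
    by (intro bdd_aboveI2)
  then show "\<delta> t \<le> (SUP y\<in>X. norm (g t y - g (t - 1) y))"
    unfolding \<delta>_def using x_in[OF t'(1)] by (rule cSUP_upper[rotated])
qed

lemma constraint_variation_nonneg: "0 \<le> constraint_variation X g T"
  using sum_\<delta>_le sum_nonneg[of "{2..T}" \<delta>] \<delta>_nonneg by fastforce

text \<open>Every epoch is charged the whole path variation, so this factor is common to all epochs
  and only \<open>sqrt (2 ^ i)\<close> is summed.\<close>

lemma epoch_path_le:
  assumes "e \<le> T"
  shows "(\<Sum>r=2^i..e. norm (xs r - xs (r - 1))) \<le> path_variation xs T"
proof -
  have "(\<Sum>r=2^i..e. norm (xs r - xs (r - 1))) \<le> (\<Sum>r=1..T. norm (xs r - xs (r - 1)))"
    using assms one_le_power[of "2::nat" i] by (intro sum_mono2) auto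
  also have "\<dots> = norm (xs 1 - xs 0) + path_variation xs T"
    using T_pos by (simp add: path_variation_def sum.atLeast_Suc_atMost numeral_2_eq_2)
  also have "norm (xs 1 - xs 0) = 0"
    using optimal by (simp add: optimal_sequence_def)
  finally show ?thesis
    by simp
qed

lemma regret_le:
  assumes AB: "0 \<le> A" "0 \<le> B"
    and drift: "\<And>i e. 2 ^ i \<le> e \<Longrightarrow> e < 2 * 2 ^ i \<Longrightarrow> e \<le> T \<Longrightarrow>
      (\<Sum>t=2^i..<e. (norm (\<gamma> t *\<^sub>R g t (x t) - P t))\<^sup>2) \<le> A * sqrt (2 ^ i) + B * (\<Sum>t=2^i+1..e. \<delta> t)"
  shows "regret f x xs T \<le> 5 * ((2 * F + A) / sqrt R + G\<^sup>2 + 14 * R) * sqrt (real T * max R (path_variation xs T))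
           + B * constraint_variation X g T"
proof -
  define M where "M = max R (path_variation xs T)"
  define D where "D = (2 * F + A) / sqrt R + G\<^sup>2 + 14 * R"
  have D: "0 \<le> D"
    using F_nonneg AB R_pos by (simp add: D_def)
  have M: "R \<le> M" "path_variation xs T \<le> M" "0 < M"
    using R_pos by (auto simp: M_def)
  have "(\<Sum>t=1..T. f t (x t) - f t (xs t)) \<le> 5 * (D * sqrt M) * real T powr (1 / 2) + B * (\<Sum>t=2..T. \<delta> t)"
  proof (rule sum_over_epochs_le)
    fix i e assume e: "2 ^ i \<le> e" "e < 2 * 2 ^ i" "e \<le> T"
    interpret ep: vqb_epoch X f df g dg R F G T xs x L P \<gamma> "2 ^ i" e
      by (rule epoch[OF e])
    define N where "N = sqrt (2 ^ i)"
    have N: "1 \<le> N"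
      by (simp add: N_def)
    \<comment> \<open>The sum is in fact at most \<open>2 * M\<close>; the square is used to get a
      rational root.\<close>
    have "R + ep.path e \<le> 2\<^sup>2 * M"
      using epoch_path_le[OF e(3), of i] M unfolding ep.path_def by simp
    then have "sqrt (R + ep.path e) \<le> sqrt (2\<^sup>2 * M)"
      by (rule real_sqrt_le_mono)
    also have "\<dots> = 2 * sqrt M"
      by (simp add: real_sqrt_mult)
    finally have "sqrt (real (2 ^ i) * (R + ep.path e)) \<le> N * (2 * sqrt M)"
      by (simp add: real_sqrt_mult N_def)
    then have "(G\<^sup>2 / 2 + 7 * R) * sqrt (real (2 ^ i) * (R + ep.path e)) \<le> (G\<^sup>2 / 2 + 7 * R) * (N * (2 * sqrt M))"
      using R_pos by (intro mult_left_mono) auto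
    also have "\<dots> = (G\<^sup>2 + 14 * R) * sqrt M * N"
      by (simp add: algebra_simps)
    finally have 1: "(G\<^sup>2 / 2 + 7 * R) * sqrt (real (2 ^ i) * (R + ep.path e)) \<le> (G\<^sup>2 + 14 * R) * sqrt M * N" .
    \<comment> \<open>Terms without the path factor are absorbed through
      \<open>sqrt M / sqrt R \<ge> 1\<close>; this is where \<open>max R\<close> enters.\<close>
    have "2 * F + A * N \<le> (2 * F + A) * N"
      using N F_nonneg mult_left_mono[of 1 N "2 * F"] by (simp add: distrib_right)
    also have "\<dots> \<le> (2 * F + A) * N * (sqrt M / sqrt R)"
      using mult_left_mono[of 1 "sqrt M / sqrt R" "(2 * F + A) * N"] N AB F_nonneg M R_pos by simp
    finally have 2: "2 * F + A * N \<le> (2 * F + A) / sqrt R * sqrt M * N"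
      by (simp add: mult_ac)
    have "(\<Sum>t=2^i..e. f t (x t) - f t (xs t)) \<le> D * sqrt M * N + B * (\<Sum>t=2^i+1..e. \<delta> t)"
      using ep.epoch_regret drift[OF e] 1 2 unfolding ep.drift_error_def D_def N_def distrib_right by linarith
    then show "(\<Sum>t=2^i..e. f t (x t) - f t (xs t))
        \<le> D * sqrt M * (2 ^ i) powr (1 / 2) + B * (\<Sum>t=2^i+1..e. \<delta> t)"
      by (simp add: N_def powr_half_sqrt)
  qed (use D M AB \<delta>_nonneg T_pos in auto)
  also have "5 * (D * sqrt M) * real T powr (1 / 2) = 5 * D * sqrt (real T * M)"
    by (simp add: powr_half_sqrt real_sqrt_mult)
  also have "B * (\<Sum>t=2..T. \<delta> t) \<le> B * constraint_variation X g T"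
    using sum_\<delta>_le AB by (intro mult_left_mono)
  finally show ?thesis
    by (simp add: regret_def sum_subtractf D_def M_def)
qed

text \<open>The exponent \<open>p\<close> collects 1/2 from the dual norm and the growth rate of
  \<open>1 / \<gamma>\<close>.\<close>

lemma violation_le:
  assumes p: "1 / 2 \<le> p" and \<Gamma>: "0 \<le> \<Gamma>"
    and weight: "\<And>i e. 2 ^ i \<le> e \<Longrightarrow> e < 2 * 2 ^ i \<Longrightarrow> e \<le> T \<Longrightarrow> sqrt (2 ^ i) / \<gamma> e \<le> \<Gamma> * (2 ^ i) powr p"
  shows "violation g x T k
    \<le> 5 * (F + sqrt (4 * F + 2 * (G\<^sup>2 / 2 + 7 * R) * sqrt (2 * R) + 9 * F\<^sup>2 * c) * \<Gamma>) * real T powr p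
      + constraint_variation X g T"
proof -
  define q where "q = sqrt (4 * F + 2 * (G\<^sup>2 / 2 + 7 * R) * sqrt (2 * R) + 9 * F\<^sup>2 * c)"
  have q: "0 \<le> q"
    using F_nonneg R_pos c_pos by (simp add: q_def)
  have "violation g x T k \<le> 5 * (F + q * \<Gamma>) * real T powr p + 1 * (\<Sum>t=2..T. \<delta> t)"
    unfolding violation_def
  proof (rule sum_over_epochs_le)
    fix i e assume e: "2 ^ i \<le> e" "e < 2 * 2 ^ i" "e \<le> T"
    interpret ep: vqb_epoch X f df g dg R F G T xs x L P \<gamma> "2 ^ i" e
      by (rule epoch[OF e])
    have "norm (L e) / \<gamma> e \<le> q * sqrt (2 ^ i) / \<gamma> e"
      using ep.dual_norm_le[OF \<gamma>_bound] \<gamma>_pos[of e] by (intro divide_right_mono) (auto simp: q_def)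
    also have "\<dots> \<le> q * (\<Gamma> * (2 ^ i) powr p)"
      using mult_left_mono[OF weight[OF e] q] by simp
    moreover have "F * 1 \<le> F * (2 ^ i) powr p"
      using F_nonneg p by (intro mult_left_mono) (auto intro: ge_one_powr_ge_zero)
    ultimately show "(\<Sum>t=2^i..e. g t (x t) $ k) \<le> (F + q * \<Gamma>) * (2 ^ i) powr p + 1 * (\<Sum>t=2^i+1..e. \<delta> t)"
      using ep.epoch_violation[of k] by (simp add: \<delta>_def distrib_right)
  qed (use F_nonneg q \<Gamma> p \<delta>_nonneg T_pos in auto)
  then show ?thesis
    using sum_\<delta>_le by (simp add: q_def)
qed

section \<open>Error term and dual weight for the two choices of \<open>\<gamma>\<close>\<close>

lemma drift_constant_gamma:
  assumes \<gamma>: "\<And>t. \<gamma> t = sqrt c" and e: "2 ^ i \<le> e" "e < 2 * 2 ^ i" "e \<le> T"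
  shows "(\<Sum>t=2^i..<e. (norm (\<gamma> t *\<^sub>R g t (x t) - P t))\<^sup>2)
    \<le> c * F\<^sup>2 * sqrt (2 ^ i) + 2 * F * c * (\<Sum>t=2^i+1..e. \<delta> t)"
proof (cases "2 ^ i = e")
  case True
  then show ?thesis
    using c_pos by simp
next
  case False
  define s where "s = (2::nat) ^ i"
  interpret ep: vqb_epoch X f df g dg R F G T xs x L P \<gamma> s e
    unfolding s_def by (rule epoch[OF e])
  have se: "s < e"
    using False e by (simp add: s_def)
  have gF: "norm (g t (x u)) \<le> F" if "t \<in> {s..e}" "u \<in> {s..e}" for t u
    using online_problemD(4)[OF problem ep.in_horizon ep.x_in, OF that] .
  \<comment> \<open>After a reset there is no previous constraint to compare with, so the first
    round is charged to the \<open>sqrt (2 ^ i)\<close> term.\<close>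
  have "(norm (\<gamma> s *\<^sub>R g s (x s) - P s))\<^sup>2 \<le> (sqrt c * F)\<^sup>2"
    using gF[of s s] se c_pos by (intro power_mono) (auto simp: ep.P_start \<gamma> intro!: mult_left_mono)
  also have "\<dots> = c * F\<^sup>2 * 1"
    using c_pos by (simp add: power_mult_distrib)
  also have "\<dots> \<le> c * F\<^sup>2 * sqrt (2 ^ i)"
    using c_pos by (intro mult_left_mono) auto
  finally have first: "(norm (\<gamma> s *\<^sub>R g s (x s) - P s))\<^sup>2 \<le> c * F\<^sup>2 * sqrt (2 ^ i)" .
  \<comment> \<open>Equal weights leave \<open>c\<close> times the square of
    \<open>\<delta> t\<close>; bounding one factor by \<open>2 * F\<close> makes this linear in the
    variation.\<close>
  have "(norm (\<gamma> t *\<^sub>R g t (x t) - P t))\<^sup>2 \<le> 2 * F * c * \<delta> t" if t: "t \<in> {s+1..<e}" for t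
  proof -
    have "P t = sqrt c *\<^sub>R g (t - 1) (x t)"
      using ep.P_step[of "t - 1"] t \<gamma> by force
    then have "(norm (\<gamma> t *\<^sub>R g t (x t) - P t))\<^sup>2 = c * (\<delta> t * \<delta> t)"
      using c_pos by (simp add: \<gamma> \<delta>_def power_mult_distrib power2_eq_square flip: scaleR_diff_right)
    also have "\<dots> \<le> c * (2 * F * \<delta> t)"
    proof (intro mult_left_mono mult_right_mono)
      have "norm (g t (x t)) \<le> F" "norm (g (t - 1) (x t)) \<le> F"
        using t by (auto intro!: gF)
      then show "\<delta> t \<le> 2 * F"
        unfolding \<delta>_def using norm_triangle_ineq4[of "g t (x t)" "g (t - 1) (x t)"] by linarith
    qed (use c_pos \<delta>_nonneg in auto)
    finally show ?thesis
      by (simp add: mult_ac)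
  qed
  then have "(\<Sum>t=s+1..<e. (norm (\<gamma> t *\<^sub>R g t (x t) - P t))\<^sup>2) \<le> (\<Sum>t=s+1..<e. 2 * F * c * \<delta> t)"
    by (rule sum_mono)
  also have "\<dots> \<le> (\<Sum>t=s+1..e. 2 * F * c * \<delta> t)"
    using F_nonneg c_pos \<delta>_nonneg by (intro sum_mono2) auto
  finally show ?thesis
    using first se by (simp add: sum.atLeast_Suc_lessThan sum_distrib_left s_def)
qed

lemma drift_decreasing_gamma:
  assumes \<gamma>: "\<And>t. (\<gamma> t)\<^sup>2 = c / sqrt (real (t - epoch_start t + 2))"
    and e: "2 ^ i \<le> e" "e < 2 * 2 ^ i" "e \<le> T"
  shows "(\<Sum>t=2^i..<e. (norm (\<gamma> t *\<^sub>R g t (x t) - P t))\<^sup>2) \<le> 8 * F\<^sup>2 * c * sqrt (2 ^ i)"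
proof -
  define s where "s = (2::nat) ^ i"
  interpret ep: vqb_epoch X f df g dg R F G T xs x L P \<gamma> s e
    unfolding s_def by (rule epoch[OF e])
  have "(norm (\<gamma> t *\<^sub>R g t (x t) - P t))\<^sup>2 \<le> 4 * F\<^sup>2 * c * (1 / sqrt (real (t - s) + 1))"
    if t: "t \<in> {s..<e}" for t
  proof -
    have "(norm (\<gamma> t *\<^sub>R g t (x t) - P t))\<^sup>2 \<le> 4 * F\<^sup>2 * (c / sqrt (real (t - s) + 1))"
    proof (rule ep.drift_term_le)
      fix u assume u: "u \<in> {s..t}" "t \<le> u + 1"
      then have "epoch_start u = s"
        using t e unfolding s_def by (intro epoch_start_eq) auto
      \<comment> \<open>The worst index is \<open>u = t - 1\<close>; the offset 2 in
        \<open>\<gamma>\<close> then leaves \<open>t - s + 1\<close>, which is positive already at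
        \<open>t = s\<close>.\<close>
      moreover have "sqrt (real (t - s) + 1) \<le> sqrt (real (u - s + 2))"
        using u by simp
      ultimately show "(\<gamma> u)\<^sup>2 \<le> c / sqrt (real (t - s) + 1)"
        unfolding \<gamma> using c_pos by (auto intro!: divide_left_mono mult_pos_pos simp del: real_sqrt_le_iff)
    qed (use t in simp)
    then show ?thesis
      by simp
  qed
  then have "(\<Sum>t=s..<e. (norm (\<gamma> t *\<^sub>R g t (x t) - P t))\<^sup>2)
      \<le> (\<Sum>t=s..<e. 4 * F\<^sup>2 * c * (1 / sqrt (real (t - s) + 1)))"
    by (rule sum_mono)
  also have "\<dots> = 4 * F\<^sup>2 * c * (\<Sum>j<e - s. 1 / sqrt (real j + 1))"
    unfolding sum_distrib_left
    by (rule sum.reindex_bij_witness[of _ "\<lambda>j. j + s" "\<lambda>t. t - s"]) auto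
  also have "\<dots> \<le> 4 * F\<^sup>2 * c * (2 * sqrt (real s))"
  proof (rule mult_left_mono)
    have "sqrt (real (e - s)) \<le> sqrt (real s)"
      using ep.range by simp
    then show "(\<Sum>j<e - s. 1 / sqrt (real j + 1)) \<le> 2 * sqrt (real s)"
      using sum_inverse_sqrt_le[of "e - s"] by linarith
  qed (use c_pos in simp)
  finally show ?thesis
    by (simp add: s_def)
qed

text \<open>\<open>1 / \<gamma> e\<close> grows like the fourth root of the position in the epoch,
  and 3/4 = 1/2 + 1/4. The generous bound \<open>16 * N\<close> has fourth root
  \<open>2 * N powr (1 / 4)\<close>.\<close>

lemma weight_decreasing_gamma:
  assumes \<gamma>: "\<And>t. (\<gamma> t)\<^sup>2 = c / sqrt (real (t - epoch_start t + 2))"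
    and e: "2 ^ i \<le> e" "e < 2 * 2 ^ i"
  shows "sqrt (2 ^ i) / \<gamma> e \<le> 2 / sqrt c * (2 ^ i) powr (3 / 4)"
proof -
  define N where "N = (2::real) ^ i"
  define m where "m = real (e - 2 ^ i + 2)"
  have "real e < 2 * N"
    using e(2) by (simp only: N_def flip: of_nat_less_iff[where 'a = real]) simp
  moreover have "N \<le> real e"
    using e(1) by (simp only: N_def flip: of_nat_le_iff[where 'a = real]) simp
  moreover have "1 \<le> N"
    by (simp add: N_def)
  moreover have "m = real e - N + 2"
    using e(1) by (simp add: m_def N_def of_nat_diff)
  ultimately have m: "0 < m" "m \<le> 16 * N"
    by linarith+
  have N: "0 < N"
    by (simp add: N_def)
  have "\<gamma> e = sqrt (c / sqrt m)"
    using \<gamma>[of e] \<gamma>_pos[of e] epoch_start_eq[OF e] by (metis m_def less_imp_le real_sqrt_unique)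
  then have "sqrt N / \<gamma> e = sqrt N * sqrt (sqrt m) / sqrt c"
    using m c_pos by (simp add: real_sqrt_divide)
  also have "\<dots> \<le> sqrt N * sqrt (sqrt (2 ^ 4 * N)) / sqrt c"
    using m N c_pos by (intro divide_right_mono mult_left_mono real_sqrt_le_mono) auto
  also have "sqrt (sqrt (2 ^ 4 * N)) = 2 * sqrt (sqrt N)"
    using N by (simp add: real_sqrt_mult)
  also have "sqrt (sqrt N) = N powr (1 / 4)"
    using N by (simp add: powr_powr flip: powr_half_sqrt)
  also have "sqrt N * (2 * N powr (1 / 4)) / sqrt c = 2 / sqrt c * N powr (3 / 4)"
    using N by (simp flip: powr_half_sqrt powr_add)
  finally show ?thesis
    by (simp add: N_def)
qed

end

theorem theorem3:
  fixes R F G :: real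
  assumes "0 < R" and "0 < G"
  shows "\<exists>C>0. \<forall>(n::nat) (T::nat) (X :: (nat \<Rightarrow>\<^sub>0 real) set) f df
            (g :: nat \<Rightarrow> (nat \<Rightarrow>\<^sub>0 real) \<Rightarrow> real ^ 'k) dg xs x \<Lambda>.
      1 \<le> T \<and> X \<subseteq> euclid n \<and>
      (\<forall>t\<in>{1..T}. \<forall>y\<in>X. df t y \<in> euclid n \<and> (\<forall>k. dg t k y \<in> euclid n)) \<and>
      online_problem X f df g dg R F G T \<and>
      optimal_sequence X f g T xs \<longrightarrow>
      (vqb_run X df g (step_alpha R xs) (step_gamma1 R (real CARD('k) * G)) T x \<Lambda> \<longrightarrow>
         regret f x xs T
           \<le> C * max (sqrt (real T * max R (path_variation xs T))) (constraint_variation X g T) \<and>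
         (\<forall>k. violation g x T k \<le> C * max (sqrt (real T)) (constraint_variation X g T))) \<and>
      (vqb_run X df g (step_alpha R xs) (step_gamma2 R (real CARD('k) * G)) T x \<Lambda> \<longrightarrow>
         regret f x xs T \<le> C * sqrt (real T * max R (path_variation xs T)) \<and>
         (\<forall>k. violation g x T k \<le> C * max (real T powr (3/4)) (constraint_variation X g T)))"
proof -
  define c where "c = 1 / (2 * (real CARD('k) * G)\<^sup>2) * (1 / sqrt (2 * R))"
  have c: "0 < c"
    using assms by (simp add: c_def)
  define q where "q = sqrt (4 * F + 2 * (G\<^sup>2 / 2 + 7 * R) * sqrt (2 * R) + 9 * F\<^sup>2 * c)"
  define a where "a A = 5 * ((2 * F + A) / sqrt R + G\<^sup>2 + 14 * R)" for A
  define b where "b \<Gamma> = 5 * (F + q * \<Gamma>)" for \<Gamma>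
  \<comment> \<open>\<open>C\<close> is fixed before any problem is given, and
    \<open>0 \<le> F\<close> follows only once one exists; the absolute values keep \<open>C\<close>
    positive regardless.\<close>
  define C where "C = 1 + (\<bar>a (c * F\<^sup>2)\<bar> + \<bar>2 * F * c\<bar>) + \<bar>b (1 / sqrt c)\<bar> + \<bar>a (8 * F\<^sup>2 * c)\<bar> + \<bar>b (2 / sqrt c)\<bar>"
  have combine: "u * y + v * z \<le> C * max y z"
    if "\<bar>u\<bar> + \<bar>v\<bar> \<le> C" "0 \<le> y" "0 \<le> z" for u v y z
  proof -
    have "u * y \<le> \<bar>u\<bar> * max y z" "v * z \<le> \<bar>v\<bar> * max y z"
      using that by (auto intro!: mult_mono)
    then have "u * y + v * z \<le> (\<bar>u\<bar> + \<bar>v\<bar>) * max y z"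
      by (simp add: distrib_right)
    also have "\<dots> \<le> C * max y z"
      using that by (intro mult_right_mono) auto
    finally show ?thesis .
  qed
  have case1: "regret f x xs T
           \<le> C * max (sqrt (real T * max R (path_variation xs T))) (constraint_variation X g T)"
      "violation g x T k \<le> C * max (sqrt (real T)) (constraint_variation X g T)"
    if "1 \<le> T" "online_problem X f df g dg R F G T" "optimal_sequence X f g T xs"
      "vqb_run X df g (step_alpha R xs) (step_gamma1 R (real CARD('k) * G)) T x \<Lambda>"
    for T and X :: "(nat \<Rightarrow>\<^sub>0 real) set" and f df and g :: "nat \<Rightarrow> _ \<Rightarrow> real ^ 'k" and dg xs x \<Lambda> k
  proof -
    have \<gamma>: "step_gamma1 R (real CARD('k) * G) t = sqrt c" for t
      by (simp add: step_gamma1_def c_def)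
    interpret vqb_doubling X f df g dg R F G T xs x \<Lambda> "step_gamma1 R (real CARD('k) * G)" c
      by unfold_locales (use that assms c in \<open>simp_all only: \<gamma> c_def[symmetric]\<close>, simp_all)
    have "regret f x xs T \<le> a (c * F\<^sup>2) * sqrt (real T * max R (path_variation xs T))
        + 2 * F * c * constraint_variation X g T"
      unfolding a_def by (intro regret_le drift_constant_gamma \<gamma>) (use c F_nonneg in auto)
    also have "\<dots> \<le> C * max (sqrt (real T * max R (path_variation xs T))) (constraint_variation X g T)"
      using assms by (intro combine constraint_variation_nonneg) (auto simp: C_def)
    finally show "regret f x xs T
           \<le> C * max (sqrt (real T * max R (path_variation xs T))) (constraint_variation X g T)" .
    have "violation g x T k \<le> b (1 / sqrt c) * real T powr (1 / 2) + constraint_variation X g T"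
      unfolding b_def q_def using c by (intro violation_le) (auto simp: \<gamma> powr_half_sqrt)
    also have "\<dots> = b (1 / sqrt c) * sqrt (real T) + 1 * constraint_variation X g T"
      by (simp add: powr_half_sqrt)
    also have "\<dots> \<le> C * max (sqrt (real T)) (constraint_variation X g T)"
      by (intro combine constraint_variation_nonneg) (auto simp: C_def)
    finally show "violation g x T k \<le> C * max (sqrt (real T)) (constraint_variation X g T)" .
  qed
  have case2: "regret f x xs T \<le> C * sqrt (real T * max R (path_variation xs T))"
      "violation g x T k \<le> C * max (real T powr (3/4)) (constraint_variation X g T)"
    if "1 \<le> T" "online_problem X f df g dg R F G T" "optimal_sequence X f g T xs"
      "vqb_run X df g (step_alpha R xs) (step_gamma2 R (real CARD('k) * G)) T x \<Lambda>"
    for T and X :: "(nat \<Rightarrow>\<^sub>0 real) set" and f df and g :: "nat \<Rightarrow> _ \<Rightarrow> real ^ 'k" and dg xs x \<Lambda> k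
  proof -
    define \<gamma> where "\<gamma> = step_gamma2 R (real CARD('k) * G)"
    have \<gamma>: "\<gamma> t = sqrt (c / sqrt (real (t - epoch_start t + 2)))" for t
      by (simp add: \<gamma>_def step_gamma2_def c_def)
    have \<gamma>2: "(\<gamma> t)\<^sup>2 = c / sqrt (real (t - epoch_start t + 2))" for t
      using c by (simp add: \<gamma>)
    interpret vqb_doubling X f df g dg R F G T xs x \<Lambda> \<gamma> c
    proof
      show "\<gamma> (t + 1) \<le> \<gamma> t" if "epoch_start (t + 1) = epoch_start t" for t
        unfolding \<gamma> that using c by (intro real_sqrt_le_mono divide_left_mono mult_pos_pos) auto
      show "(\<gamma> t)\<^sup>2 \<le> c" for t
        unfolding \<gamma>2 using c by (simp add: divide_le_eq)
      show "0 < \<gamma> t" for t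
        using c by (simp add: \<gamma>)
    qed (use that assms in \<open>simp_all add: \<gamma>_def c_def\<close>)
    have "regret f x xs T \<le> a (8 * F\<^sup>2 * c) * sqrt (real T * max R (path_variation xs T))
        + 0 * constraint_variation X g T"
      unfolding a_def by (intro regret_le) (use c drift_decreasing_gamma[OF \<gamma>2] in auto)
    also have "\<dots> \<le> C * sqrt (real T * max R (path_variation xs T))"
      using assms combine[of "a (8 * F\<^sup>2 * c)" 0 "sqrt (real T * max R (path_variation xs T))" 0]
      by (simp add: C_def max_absorb1)
    finally show "regret f x xs T \<le> C * sqrt (real T * max R (path_variation xs T))" .
    have "violation g x T k \<le> b (2 / sqrt c) * real T powr (3/4) + 1 * constraint_variation X g T"
      unfolding b_def q_def mult_1 using c weight_decreasing_gamma[OF \<gamma>2] by (intro violation_le) auto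
    also have "\<dots> \<le> C * max (real T powr (3/4)) (constraint_variation X g T)"
      by (intro combine constraint_variation_nonneg) (auto simp: C_def)
    finally show "violation g x T k \<le> C * max (real T powr (3/4)) (constraint_variation X g T)" .
  qed
  have C_pos: "0 < C"
    by (simp add: C_def add_pos_nonneg)
  show ?thesis
    by (intro exI[of _ C] conjI allI impI C_pos; elim conjE; rule case1 case2; assumption)
qed

end
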